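(* Let $\mathrm{Re}(s)>1$ and $\tau\in\mathbb{H}$ (the upper half-plane). Then $$\Psi_s(\tau)=\frac{2(1-e^{-2\pi is})}{(1+e^{-2\pi is})\,\zeta(2s)}\,\psi_s^+(\tau).$$
   Context: For $s\in\mathbb{C}$, $\tau\in\mathbb{H}=\{\tau\in\mathbb{C}:\mathrm{Im}(\tau)>0\}$ and $q=e^{2\pi i\tau}$, the Eisenstein series is $$E_s(\tau)=1+\frac{2}{\zeta(1-s)}\sum_{n=1}^\infty\sigma_{s-1}(n)q^n,\qquad\sigma_s(n)=\sum_{d\mid n}d^s,$$ where $\zeta$ is the Riemann zeta function, and $$\Psi_s(\tau)=E_{2s}(\tau)-\frac{1}{\tau^{2s}}E_{2s}\left(-\frac1\tau\right).$$ For $\mathrm{Re}(s)>1$ and $\tau\in\mathbb{H}$, $$\psi_s^+(\tau)={\sum_{m,n\ge0}}^{*}\frac{1}{(m\tau+n)^{2s}},$$ where $*$ means that the term $m=n=0$ is omitted and the terms with either $m$ or $n$ equal to $0$ are counted with multiplicity $\frac12$. Complex powers are principal.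
   Formalization: The formal statement also assumes 1+e^{-2πis} ≠ 0, excluding s = 3/2, 5/2, …, where ζ(1−2s) = 0 and both sides of the printed identity are undefined. *)

theory Defs
  imports "HOL-Complex_Analysis.Complex_Analysis"
begin

(* The Riemann zeta function: the unique holomorphic function on the plane minus 1 that extends
   the Dirichlet series from Re w > 1.  The clause f 1 = 0 only fixes a value at the pole, so that
   the description is unique; it makes 2 / riemann_zeta 1 = 0, in line with 1 / infinity = 0. *)
definition riemann_zeta :: "complex \<Rightarrow> complex" where
  "riemann_zeta = (THE f. f holomorphic_on (- {1}) \<and>
      (\<forall>w. Re w > 1 \<longrightarrow> f w = (\<Sum>n. 1 / of_nat (Suc n) powr w)) \<and> f 1 = 0)"

definition divisor_sum :: "complex \<Rightarrow> nat \<Rightarrow> complex" where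
  "divisor_sum s n = (\<Sum>d | d dvd n. of_nat d powr s)"

(* Complex powr is the principal power z powr w = exp (w * Ln z), with Im (Ln z) in (-pi, pi].
   The index is shifted by one since the series starts at n = 1. *)
definition eisenstein :: "complex \<Rightarrow> complex \<Rightarrow> complex" where
  "eisenstein s \<tau> = 1 + 2 / riemann_zeta (1 - s) *
      (\<Sum>n. divisor_sum (s - 1) (Suc n) * exp (2 * of_real pi * \<i> * \<tau>) ^ Suc n)"

definition eisenstein_period :: "complex \<Rightarrow> complex \<Rightarrow> complex" where
  "eisenstein_period s \<tau> =
      eisenstein (2 * s) \<tau> - 1 / \<tau> powr (2 * s) * eisenstein (2 * s) (- 1 / \<tau>)"

(* The starred lattice sum, taken unconditionally: it converges absolutely for Re s > 1, Im tau > 0. *)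
definition psi_plus :: "complex \<Rightarrow> complex \<Rightarrow> complex" where
  "psi_plus s \<tau> = (\<Sum>\<^sub>\<infinity>(m, n) \<in> UNIV - {(0 :: nat, 0 :: nat)}.
      (if m = 0 \<or> n = 0 then 1 / 2 else 1) * (1 / (of_nat m * \<tau> + of_nat n) powr (2 * s)))"

end

theory Submission
  imports Defs "HOL-Real_Asymp.Real_Asymp"
begin

text \<open>
  Put \<open>w = 2 s\<close> and \<open>e = exp (- \<pi> \<i> w)\<close>. Everything is compared with the lattice sum
  \<open>L(\<tau>) = \<Sum> (m \<tau> + n)\<^sup>-\<^sup>w\<close> over \<open>m \<ge> 1\<close> and all integers \<open>n\<close>. Lipschitz' formula turns each row
  of \<open>L\<close> into a power series in \<open>q\<close>, so \<open>L\<close> is a multiple of \<open>\<Sum> \<sigma>\<^bsub>w-1\<^esub>(n) q\<^sup>n\<close>; the functional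
  equation of \<open>\<zeta>\<close> absorbs the Gamma factor, with the result
  \<open>E\<^sub>w = 1 + 2 L / ((1 + e) \<zeta>(w))\<close> (\<open>eisenstein_eq_lattice_sum\<close>).

  By the sign of \<open>n\<close>, \<open>L(\<tau>) = A(\<tau>) + \<tau>\<^sup>-\<^sup>w \<zeta>(w) + B(\<tau>)\<close>. Multiplication of \<open>L(-1/\<tau>)\<close> by \<open>\<tau>\<^sup>-\<^sup>w\<close>
  turns \<open>A\<close> into \<open>B\<close>, because principal powers multiply as long as the arguments add up to less
  than \<open>\<pi>\<close>; it turns the middle term and \<open>B\<close> into \<open>e \<zeta>(w)\<close> and \<open>e A\<close>, because there the arguments
  add up to \<open>\<pi>\<close> or more (\<open>lattice_sum_inversion\<close>). In the difference \<open>\<Psi>\<^sub>s\<close> the sum \<open>B\<close> cancels and \<open>A\<close> gets the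
  factor \<open>1 - e\<close>. The terms without \<open>A\<close> combine to \<open>(1 - e) / (1 + e) (1 + \<tau>\<^sup>-\<^sup>w)\<close>, which is what the
  two boundary rays of \<open>\<psi>\<^sub>s\<^sup>+\<close> contribute with their weights \<open>1/2\<close>.

  Lipschitz' formula \<open>\<Gamma>(w) \<Sum>\<^sub>n (y + 2 \<pi> \<i> n)\<^sup>-\<^sup>w = \<Sum>\<^sub>n n\<^sup>w\<^sup>-\<^sup>1 exp (- n y)\<close> is proved without Fourier analysis.
  The left-hand sum is \<open>2 \<pi> \<i>\<close>-periodic and bounded for large \<open>Re y\<close>, so it is a power series in \<open>exp (- y)\<close>.
  It satisfies a distribution relation, since the shifts by \<open>2 \<pi> \<i> j / m\<close> with \<open>j < m\<close> refine the lattice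
  \<open>2 \<pi> \<i> \<int>\<close>; this forces the coefficients to be \<open>c n\<^sup>w\<^sup>-\<^sup>1\<close>. The constant is found by letting \<open>y\<close> tend
  to \<open>0\<close>: one side grows like \<open>y\<^sup>-\<^sup>w\<close>, the other like \<open>c \<Gamma>(w) y\<^sup>-\<^sup>w\<close> by comparison with the binomial
  series (\<open>polylog_abelian\<close>).

  The functional equation is a consequence of Lipschitz' formula. The series
  \<open>\<Sum> n\<^sup>-\<^sup>s (1 + n y) exp (- n y)\<close>, freed from its singular part at \<open>y = 0\<close>, has a \<open>y\<close>-derivative that
  Lipschitz' formula bounds locally uniformly for \<open>Re s < 2\<close>, \<open>s \<noteq> 1\<close>. So it has a limit as \<open>y\<close> tends to \<open>0\<close>
  which is holomorphic in \<open>s\<close>. The limit is the Dirichlet series for \<open>1 < Re s < 2\<close>, and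
  \<open>\<Gamma>(1-s) \<Sum>\<^bsub>n\<noteq>0\<^esub> (2 \<pi> \<i> n)\<^sup>s\<^sup>-\<^sup>1\<close> for \<open>Re s < 0\<close>.
\<close>

section \<open>Infinite sums of holomorphic functions\<close>

lemma infsum_holomorphic_on:
  fixes f :: "'a \<Rightarrow> complex \<Rightarrow> complex"
  assumes S: "open S"
    and hol: "\<And>n. n \<in> X \<Longrightarrow> f n holomorphic_on S"
    and bound: "\<And>z. z \<in> S \<Longrightarrow> \<exists>r>0. \<exists>M. cball z r \<subseteq> S \<and> M summable_on X \<and>
                  (\<forall>n\<in>X. \<forall>u\<in>cball z r. norm (f n u) \<le> M n)"
  shows "(\<lambda>z. \<Sum>\<^sub>\<infinity>n\<in>X. f n z) holomorphic_on S"
proof -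
  have "(\<lambda>z. \<Sum>\<^sub>\<infinity>n\<in>X. f n z) field_differentiable (at z)" if z: "z \<in> S" for z
  proof -
    obtain r M where r: "r > 0" "cball z r \<subseteq> S" and M: "M summable_on X"
      and le: "\<And>n u. n \<in> X \<Longrightarrow> u \<in> cball z r \<Longrightarrow> norm (f n u) \<le> M n"
      using bound[OF z] by blast
    have lim: "uniform_limit (cball z r) (\<lambda>A u. \<Sum>n\<in>A. f n u) (\<lambda>u. \<Sum>\<^sub>\<infinity>n\<in>X. f n u) (finite_subsets_at_top X)"
      by (rule Weierstrass_m_test_general[OF le M])
    have "eventually (\<lambda>A. continuous_on (cball z r) (\<lambda>u. \<Sum>n\<in>A. f n u) \<and>
            (\<lambda>u. \<Sum>n\<in>A. f n u) holomorphic_on ball z r) (finite_subsets_at_top X)"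
    proof (rule eventually_finite_subsets_at_top_weakI)
      fix A assume "finite A" "A \<subseteq> X"
      hence "(\<lambda>u. \<Sum>n\<in>A. f n u) holomorphic_on S"
        by (intro holomorphic_intros hol) auto
      thus "continuous_on (cball z r) (\<lambda>u. \<Sum>n\<in>A. f n u) \<and>
            (\<lambda>u. \<Sum>n\<in>A. f n u) holomorphic_on ball z r"
        using r by (meson ball_subset_cball continuous_on_subset holomorphic_on_imp_continuous_on
                    holomorphic_on_subset order_trans)
    qed
    from holomorphic_uniform_limit[OF this lim]
    have "(\<lambda>z. \<Sum>\<^sub>\<infinity>n\<in>X. f n z) holomorphic_on ball z r" by auto
    thus ?thesis using r by (simp add: holomorphic_on_imp_differentiable_at)
  qed
  thus ?thesis
    by (simp add: S holomorphic_on_def field_differentiable_at_within)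
qed

lemma infsum_continuous_on:
  fixes f :: "'a \<Rightarrow> complex \<Rightarrow> complex"
  assumes cont: "\<And>n. n \<in> X \<Longrightarrow> continuous_on S (f n)"
    and M: "M summable_on X" and le: "\<And>n u. n \<in> X \<Longrightarrow> u \<in> S \<Longrightarrow> norm (f n u) \<le> M n"
  shows "continuous_on S (\<lambda>z. \<Sum>\<^sub>\<infinity>n\<in>X. f n z)"
proof (rule uniform_limit_theorem)
  show "uniform_limit S (\<lambda>A u. \<Sum>n\<in>A. f n u) (\<lambda>u. \<Sum>\<^sub>\<infinity>n\<in>X. f n u) (finite_subsets_at_top X)"
    by (rule Weierstrass_m_test_general[OF le M])
  show "\<forall>\<^sub>F A in finite_subsets_at_top X. continuous_on S (\<lambda>u. \<Sum>n\<in>A. f n u)"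
    by (rule eventually_finite_subsets_at_top_weakI) (auto intro!: continuous_intros cont)
qed auto

lemma summable_on_int_powr:
  assumes "\<sigma> > (1::real)"
  shows "(\<lambda>n::int. (1 + \<bar>real_of_int n\<bar>) powr (-\<sigma>)) summable_on UNIV"
proof -
  let ?f = "\<lambda>n::int. (1 + \<bar>real_of_int n\<bar>) powr (-\<sigma>)"
  have s0: "summable (\<lambda>n. real n powr (-\<sigma>))"
    using assms by (subst summable_real_powr_iff) auto
  have s1: "summable (\<lambda>n. real (Suc n) powr (-\<sigma>))"
    using s0 by (subst summable_Suc_iff)
  have s2: "summable (\<lambda>n. real (Suc (Suc n)) powr (-\<sigma>))"
    using s1 by (subst (asm) summable_Suc_iff[symmetric])
  have a: "?f summable_on range int"
  proof (subst summable_on_reindex)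
    show "(?f \<circ> int) summable_on UNIV"
      using s1 by (intro summable_nonneg_imp_summable_on) (auto simp: o_def add_ac)
  qed auto
  have b: "?f summable_on range (\<lambda>n. - int n - 1)"
  proof (subst summable_on_reindex)
    show "(?f \<circ> (\<lambda>n. - int n - 1)) summable_on UNIV"
      using s2 by (intro summable_nonneg_imp_summable_on) (auto simp: o_def add_ac)
  qed (auto simp: inj_on_def)
  have "n \<in> range int \<union> range (\<lambda>n. - int n - 1)" for n :: int
  proof (cases "n \<ge> 0")
    case True
    hence "n = int (nat n)" by simp
    thus ?thesis by blast
  next
    case False
    hence "n = - int (nat (-n-1)) - 1" by simp
    thus ?thesis by blast
  qed
  hence "range int \<union> range (\<lambda>n. - int n - 1) = UNIV" by blast
  thus ?thesis using summable_on_union[OF a b] by simp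
qed

text \<open>
  Majorants for the lattice sums: a lower bound for \<open>norm z\<close> controls a complex power because
  the argument of \<open>z\<close> contributes at most \<open>exp (pi * \<bar>Im w\<bar>)\<close>.
\<close>

lemma norm_powr_uminus_le:
  fixes z w :: complex
  assumes "b \<le> K * norm z" "b > 0" "K > 0" "Re w \<ge> 0"
  shows "norm (z powr (-w)) \<le> exp (pi * \<bar>Im w\<bar>) * K powr Re w * b powr (- Re w)"
proof -
  have z: "z \<noteq> 0" using assms by auto
  have "norm (z powr (-w)) = norm z powr (- Re w) * exp (Im w * Arg z)"
    by (simp add: norm_powr_complex)
  moreover have "exp (Im w * Arg z) \<le> exp (pi * \<bar>Im w\<bar>)"
  proof -
    have "\<bar>Arg z\<bar> \<le> pi" using Arg_bounded[of z] by auto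
    hence "\<bar>Im w * Arg z\<bar> \<le> \<bar>Im w\<bar> * pi" by (simp add: abs_mult mult_left_mono)
    thus ?thesis by (auto simp: mult.commute)
  qed
  moreover have "norm z powr (- Re w) \<le> (b / K) powr (- Re w)"
    using assms by (intro powr_mono2') (auto simp: field_simps)
  moreover have "(b / K) powr (- Re w) = K powr Re w * b powr (- Re w)"
    using assms by (simp add: powr_divide powr_minus divide_simps)
  ultimately have "norm (z powr (-w)) \<le> (K powr Re w * b powr (- Re w)) * exp (pi * \<bar>Im w\<bar>)"
    using mult_mono[of "norm z powr (- Re w)" "K powr Re w * b powr (- Re w)"
        "exp (Im w * Arg z)" "exp (pi * \<bar>Im w\<bar>)"] by simp
  thus ?thesis by (simp add: mult_ac)
qed

section \<open>The sum over a translated lattice line\<close>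

definition lipschitz_sum :: "complex \<Rightarrow> complex \<Rightarrow> complex" where
  "lipschitz_sum w y = (\<Sum>\<^sub>\<infinity>n::int. (y + 2 * of_real pi * \<i> * of_int n) powr (-w))"

text \<open>
  The real part of \<open>y\<close> keeps the points away from \<open>0\<close>, the bound on its imaginary part makes them
  grow linearly in \<open>n\<close>; the constant is uniform on a half-strip.
\<close>

lemma shift_lower_bound:
  assumes "Re y \<ge> \<delta>" "\<delta> > 0" "\<bar>Im y\<bar> \<le> B"
  shows "1 + \<bar>real_of_int n\<bar> \<le> (1 + (1 + B) / \<delta>) * norm (y + 2 * of_real pi * \<i> * of_int n)"
proof -
  let ?z = "y + 2 * of_real pi * \<i> * of_int n"
  have "\<delta> \<le> norm ?z"
    using complex_Re_le_cmod[of ?z] assms by simp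
  hence "(1 + B) / \<delta> * \<delta> \<le> (1 + B) / \<delta> * norm ?z"
    using assms by (intro mult_left_mono) auto
  hence 1: "1 + B \<le> (1 + B) / \<delta> * norm ?z" using assms by simp
  have "\<bar>Im y + 2 * pi * real_of_int n\<bar> \<le> norm ?z"
    using abs_Im_le_cmod[of ?z] by simp
  moreover have "\<bar>2 * pi * real_of_int n\<bar> \<le> \<bar>Im y + 2 * pi * real_of_int n\<bar> + \<bar>Im y\<bar>" by linarith
  moreover have "\<bar>real_of_int n\<bar> \<le> \<bar>2 * pi * real_of_int n\<bar>"
    using pi_gt3 by (simp add: abs_mult mult_le_cancel_right1)
  ultimately have "\<bar>real_of_int n\<bar> \<le> norm ?z + B" using assms by linarith
  with 1 show ?thesis by (simp add: algebra_simps)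
qed

lemma lipschitz_sum_majorant:
  assumes "Re w > 1" "\<delta> > 0" "B \<ge> 0"
  obtains C where "C \<ge> 0" "\<And>y n. Re y \<ge> \<delta> \<Longrightarrow> \<bar>Im y\<bar> \<le> B \<Longrightarrow>
    norm ((y + 2 * of_real pi * \<i> * of_int n) powr (-w)) \<le> C * (1 + \<bar>real_of_int n\<bar>) powr (- Re w)"
proof
  let ?K = "1 + (1 + B) / \<delta>"
  have K: "?K > 0" using assms by (simp add: add_pos_pos)
  show "exp (pi * \<bar>Im w\<bar>) * ?K powr Re w \<ge> 0" by simp
  show "norm ((y + 2 * of_real pi * \<i> * of_int n) powr (-w))
         \<le> exp (pi * \<bar>Im w\<bar>) * ?K powr Re w * (1 + \<bar>real_of_int n\<bar>) powr (- Re w)"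
    if "Re y \<ge> \<delta>" "\<bar>Im y\<bar> \<le> B" for y and n :: int
    using shift_lower_bound[OF that(1) assms(2) that(2), of n] K assms
    by (intro norm_powr_uminus_le) auto
qed

lemma lipschitz_sum_abs_summable:
  assumes "Re w > 1" "Re y > 0"
  shows "(\<lambda>n::int. norm ((y + 2 * of_real pi * \<i> * of_int n) powr (-w))) summable_on UNIV"
proof -
  obtain C where C: "\<And>y' n. Re y' \<ge> Re y \<Longrightarrow> \<bar>Im y'\<bar> \<le> \<bar>Im y\<bar> \<Longrightarrow>
    norm ((y' + 2 * of_real pi * \<i> * of_int n) powr (-w)) \<le> C * (1 + \<bar>real_of_int n\<bar>) powr (- Re w)"
    by (rule lipschitz_sum_majorant[OF assms, of "\<bar>Im y\<bar>"]) auto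
  show ?thesis
    by (rule Infinite_Sum.abs_summable_on_comparison_test'[OF summable_on_cmult_right[OF summable_on_int_powr[OF assms(1)], of C]])
       (auto intro: C)
qed

lemmas lipschitz_sum_summable = abs_summable_summable[OF lipschitz_sum_abs_summable]

lemma lipschitz_sum_holomorphic:
  assumes w: "Re w > 1"
  shows "lipschitz_sum w holomorphic_on {y. Re y > 0}"
  unfolding lipschitz_sum_def
proof (rule infsum_holomorphic_on)
  show "open {y. Re y > 0}" by (simp add: open_halfspace_Re_gt)
  show "(\<lambda>y. (y + 2 * of_real pi * \<i> * of_int n) powr (-w)) holomorphic_on {y. Re y > 0}" for n :: int
    by (intro holomorphic_intros) (auto simp: complex_nonpos_Reals_iff)
  fix z assume z: "z \<in> {y. Re y > 0}"
  define r where "r = Re z / 2"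
  have r: "r > 0" using z by (simp add: r_def)
  have ball: "Re u \<ge> r \<and> \<bar>Im u\<bar> \<le> \<bar>Im z\<bar> + r" if "u \<in> cball z r" for u
  proof -
    have "norm (z - u) \<le> r" using that by (simp add: dist_norm)
    thus ?thesis
      using abs_Re_le_cmod[of "z-u"] abs_Im_le_cmod[of "z-u"] by (auto simp: r_def)
  qed
  obtain C where C: "\<And>y' n. Re y' \<ge> r \<Longrightarrow> \<bar>Im y'\<bar> \<le> \<bar>Im z\<bar> + r \<Longrightarrow>
    norm ((y' + 2 * of_real pi * \<i> * of_int n) powr (-w)) \<le> C * (1 + \<bar>real_of_int n\<bar>) powr (- Re w)"
    by (rule lipschitz_sum_majorant[OF w r, of "\<bar>Im z\<bar> + r"]) (use r in auto)
  have "cball z r \<subseteq> {y. Re y > 0}"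
    using ball r by fastforce
  moreover note r summable_on_cmult_right[OF summable_on_int_powr[OF w], of C]
  moreover have "\<forall>n\<in>UNIV. \<forall>u\<in>cball z r. norm ((u + 2 * of_real pi * \<i> * of_int n) powr (-w))
                  \<le> C * (1 + \<bar>real_of_int n\<bar>) powr (- Re w)"
    using C ball by blast
  ultimately show "\<exists>r>0. \<exists>M. cball z r \<subseteq> {y. Re y > 0} \<and> M summable_on UNIV \<and>
          (\<forall>n\<in>UNIV. \<forall>u\<in>cball z r. norm ((u + 2 * of_real pi * \<i> * of_int n) powr (-w)) \<le> M (n::int))"
    by (intro exI[of _ r] exI[of _ "\<lambda>n. C * (1 + \<bar>real_of_int n\<bar>) powr (- Re w)"] conjI) auto
qed

lemma lipschitz_sum_periodic:
  "lipschitz_sum w (y + 2 * of_real pi * \<i> * of_int k) = lipschitz_sum w y"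
  unfolding lipschitz_sum_def
proof (rule infsum_reindex_bij_witness[of _ "\<lambda>n. n - k" "\<lambda>n. n + k"])
  show "(y + 2 * of_real pi * \<i> * of_int (n + k)) powr - w =
        (y + 2 * of_real pi * \<i> * of_int k + 2 * of_real pi * \<i> * of_int n) powr - w" for n
    by (simp only: of_int_add distrib_left add_ac)
qed auto

text \<open>
  By periodicity the half-strip \<open>\<bar>Im y\<bar> \<le> 2 * pi\<close> suffices, where one majorant serves all \<open>y\<close>.
\<close>

lemma lipschitz_sum_bounded:
  assumes w: "Re w > 1"
  obtains B where "\<And>y. Re y \<ge> 1 \<Longrightarrow> norm (lipschitz_sum w y) \<le> B"
proof -
  obtain C where C: "\<And>y n. Re y \<ge> 1 \<Longrightarrow> \<bar>Im y\<bar> \<le> 2 * pi \<Longrightarrow>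
    norm ((y + 2 * of_real pi * \<i> * of_int n) powr (-w)) \<le> C * (1 + \<bar>real_of_int n\<bar>) powr (- Re w)"
    by (rule lipschitz_sum_majorant[OF w, of 1 "2 * pi"]) auto
  let ?M = "\<lambda>n::int. C * (1 + \<bar>real_of_int n\<bar>) powr (- Re w)"
  have M: "?M summable_on UNIV" by (intro summable_on_cmult_right summable_on_int_powr w)
  show ?thesis
  proof (rule that)
    fix y assume y: "Re y \<ge> 1"
    define k where "k = \<lfloor>Im y / (2 * pi)\<rfloor>"
    define y' where "y' = y - 2 * of_real pi * \<i> * of_int k"
    have "of_int k \<le> Im y / (2*pi)" "Im y / (2*pi) < of_int k + 1"
      by (auto simp: k_def)
    hence "of_int k * (2*pi) \<le> Im y" "Im y < (of_int k + 1) * (2*pi)"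
      by (auto simp: pos_le_divide_eq pos_divide_less_eq)
    hence y': "Re y' \<ge> 1" "\<bar>Im y'\<bar> \<le> 2 * pi"
      using y by (auto simp: y'_def algebra_simps)
    have "lipschitz_sum w y = lipschitz_sum w y'"
      using lipschitz_sum_periodic[of w y' k] by (simp add: y'_def)
    moreover have "norm (lipschitz_sum w y') \<le> infsum ?M UNIV"
      unfolding lipschitz_sum_def
      by (rule norm_infsum_le[OF has_sum_infsum has_sum_infsum[OF M]])
         (use y' in \<open>auto intro!: C lipschitz_sum_summable[OF w]\<close>)
    ultimately show "norm (lipschitz_sum w y) \<le> infsum ?M UNIV" by simp
  qed
qed

lemma lipschitz_sum_eq_of_exp_eq:
  assumes "exp y = exp y'"
  shows "lipschitz_sum w y = lipschitz_sum w y'"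
proof -
  obtain k :: int where "y = y' + of_real (of_int (2 * k) * pi) * \<i>"
    using assms unfolding exp_eq by blast
  hence "y = y' + 2 * of_real pi * \<i> * of_int k" by (simp add: mult_ac)
  thus ?thesis by (simp only: lipschitz_sum_periodic)
qed

text \<open>
  A periodic holomorphic function of \<open>y\<close> is a holomorphic function of \<open>q = exp (- y)\<close> on the punctured
  disc; boundedness for large \<open>Re y\<close> makes the singularity at \<open>q = 0\<close> removable.
\<close>

lemma lipschitz_sum_descends:
  assumes w: "Re w > 1"
  obtains g where "g holomorphic_on ball 0 1"
    "\<And>y. Re y > 0 \<Longrightarrow> g (exp (-y)) = lipschitz_sum w y"
proof -
  define f where "f = (\<lambda>q. lipschitz_sum w (- Ln q))"
  let ?S = "ball 0 1 - {0 :: complex}"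
  have Re_Ln_neg: "Re (- Ln q) > 0" if "q \<in> ?S" for q
    using that by (simp add: Re_Ln)
  have "f field_differentiable (at p within ?S)" if p: "p \<in> ?S" for p
  proof -
    \<comment> \<open>The branch of the logarithm centred at \<open>p\<close> avoids the cut of \<open>Ln\<close>.\<close>
    let ?l = "\<lambda>q. - (Ln (q / p) + Ln p)"
    have "lipschitz_sum w field_differentiable (at (?l p))"
      using p Re_Ln_neg[OF p] lipschitz_sum_holomorphic[OF w]
      by (intro holomorphic_on_imp_differentiable_at[of _ "{y. Re y > 0}"]) (auto simp: open_halfspace_Re_gt)
    then obtain D where D: "(lipschitz_sum w has_field_derivative D) (at (?l p))"
      by (auto simp: field_differentiable_def)
    have L: "(?l has_field_derivative - (1 / p)) (at p)"
      using p by (auto intro!: derivative_eq_intros)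
    have "(\<lambda>q. lipschitz_sum w (?l q)) field_differentiable (at p within ?S)"
      using DERIV_chain2[OF D L] field_differentiable_def field_differentiable_at_within by blast
    thus ?thesis
    proof (rule field_differentiable_transform_within[rotated 3])
      fix q assume q: "q \<in> ?S"
      have "exp (?l q) = exp (- Ln q)"
        using p q by (simp add: exp_minus exp_add exp_diff inverse_eq_divide)
      thus "lipschitz_sum w (?l q) = f q"
        unfolding f_def by (rule lipschitz_sum_eq_of_exp_eq)
    qed (use p in \<open>auto intro: zero_less_one\<close>)
  qed
  hence hol: "f holomorphic_on ?S" by (simp add: holomorphic_on_def)
  obtain B where B: "\<And>y. Re y \<ge> 1 \<Longrightarrow> norm (lipschitz_sum w y) \<le> B"
    using lipschitz_sum_bounded[OF w] by blast
  have "eventually (\<lambda>q. norm (f q) \<le> B) (at 0)"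
    unfolding eventually_at
  proof (intro exI[of _ "exp (-1)"] conjI ballI impI)
    fix q :: complex assume q: "q \<noteq> 0 \<and> dist q 0 < exp (-1)"
    hence "ln (norm q) \<le> ln (exp (-1))" by (subst ln_le_cancel_iff) auto
    thus "norm (f q) \<le> B" unfolding f_def using q by (intro B) (auto simp: Re_Ln)
  qed auto
  then obtain g where g: "g holomorphic_on ball 0 1" "\<And>q. q \<in> ?S \<Longrightarrow> g q = f q"
    using holomorphic_on_extend_bounded[OF hol] by auto
  show ?thesis
  proof
    show "g holomorphic_on ball 0 1" by fact
    fix y :: complex assume "Re y > 0"
    hence "g (exp (-y)) = f (exp (-y))" by (intro g(2)) auto
    also have "\<dots> = lipschitz_sum w y"
      unfolding f_def by (rule lipschitz_sum_eq_of_exp_eq) (simp add: exp_minus)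
    finally show "g (exp (-y)) = lipschitz_sum w y" .
  qed
qed

text \<open>
  Dividing the line \<open>m * v + 2 \<pi> \<i> \<int>\<close> by \<open>m\<close> gives \<open>m\<close> translates of \<open>v + 2 \<pi> \<i> \<int>\<close>, one for each
  residue class modulo \<open>m\<close>.
\<close>

lemma lipschitz_sum_distribution:
  assumes w: "Re w > 1" and v: "Re v > 0" and m: "m > (0::nat)"
  shows "(\<Sum>j<m. lipschitz_sum w (v + 2 * of_real pi * \<i> * of_nat j / of_nat m))
         = of_nat m powr w * lipschitz_sum w (of_nat m * v)"
proof -
  let ?f = "\<lambda>k::int. (of_nat m * v + 2 * of_real pi * \<i> * of_int k) powr (-w)"
  have summ: "?f summable_on UNIV"
    using lipschitz_sum_summable[OF w, of "of_nat m * v"] v m by simp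
  have bij: "bij_betw (\<lambda>(j, n). int j + int m * n) ({..<m} \<times> UNIV) (UNIV :: int set)"
    by (rule bij_betwI[where g = "\<lambda>k. (nat (k mod int m), k div int m)"])
       (use m in \<open>auto simp: nat_less_iff\<close>)
  have "of_nat m powr w * lipschitz_sum w (of_nat m * v) = of_nat m powr w * infsum ?f UNIV"
    by (simp add: lipschitz_sum_def)
  also have "infsum ?f UNIV = (\<Sum>\<^sub>\<infinity>(j, n)\<in>{..<m} \<times> UNIV. ?f (int j + int m * n))"
    by (subst infsum_reindex_bij_betw[OF bij, symmetric]) (simp add: case_prod_unfold)
  also have "\<dots> = (\<Sum>\<^sub>\<infinity>j\<in>{..<m}. \<Sum>\<^sub>\<infinity>n. ?f (int j + int m * n))"
    using summable_on_reindex_bij_betw[OF bij, of ?f] summ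
    by (intro infsum_Sigma'_banach[symmetric]) (simp add: case_prod_unfold)
  also have "\<dots> = (\<Sum>j<m. \<Sum>\<^sub>\<infinity>n. ?f (int j + int m * n))" by simp
  also have "of_nat m powr w * \<dots> = (\<Sum>j<m. \<Sum>\<^sub>\<infinity>n. of_nat m powr w * ?f (int j + int m * n))"
    by (simp add: sum_distrib_left infsum_cmult_right')
  also have "\<dots> = (\<Sum>j<m. lipschitz_sum w (v + 2 * of_real pi * \<i> * of_nat j / of_nat m))"
    unfolding lipschitz_sum_def
  proof (intro sum.cong refl infsum_cong)
    fix j :: nat and n :: int
    let ?z = "v + 2 * of_real pi * \<i> * of_nat j / of_nat m + 2 * of_real pi * \<i> * of_int n"
    have "of_nat m * v + 2 * of_real pi * \<i> * of_int (int j + int m * n) = of_nat m * ?z"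
      using m by (simp add: field_simps)
    also have "\<dots> powr (-w) = of_nat m powr (-w) * ?z powr (-w)"
      by (rule powr_times_real_left) auto
    finally show "of_nat m powr w * ?f (int j + int m * n) = ?z powr (-w)"
      using m by (simp add: powr_minus)
  qed
  finally show ?thesis by simp
qed

text \<open>
  In terms of \<open>q\<close> the distribution relation reads \<open>\<Sum>\<^sub>j g (\<omega>\<^sub>j q) = m\<^sup>w g (q\<^sup>m)\<close> with \<open>\<omega>\<^sub>j\<close> the
  \<open>m\<close>-th roots of unity. Comparison of the coefficients of \<open>q\<^sup>m\<^sup>k\<close> gives \<open>m c\<^sub>m\<^sub>k = m\<^sup>w c\<^sub>k\<close>. The case
  \<open>k = 1\<close> determines all coefficients of positive index, the case \<open>k = 0\<close>, \<open>m = 2\<close> shows \<open>c\<^sub>0 = 0\<close>,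
  in agreement with \<open>0 powr (w - 1) = 0\<close>.
\<close>

lemma lipschitz_sum_power_series:
  assumes w: "Re w > 1"
  obtains c where
    "\<And>y. Re y > 0 \<Longrightarrow> (\<lambda>n. c * of_nat n powr (w - 1) * exp (-y) ^ n) sums lipschitz_sum w y"
proof -
  obtain g where g: "g holomorphic_on ball 0 1"
    and gT: "\<And>y. Re y > 0 \<Longrightarrow> g (exp (-y)) = lipschitz_sum w y"
    using lipschitz_sum_descends[OF w] by blast
  define F where "F = fps_expansion g 0"
  have gF: "g has_fps_expansion F"
    unfolding F_def by (rule has_fps_expansion_fps_expansion[OF _ _ g]) auto
  have hecke: "of_nat m * fps_nth F (m * k) = of_nat m powr w * fps_nth F k" if m: "m > 0" for m k
  proof -
    define \<omega> :: "nat \<Rightarrow> complex" where "\<omega> = (\<lambda>j. exp (- (2 * of_real pi * \<i> * of_nat j / of_nat m)))"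
    have norm_\<omega>: "norm (\<omega> j) = 1" for j
      by (simp add: \<omega>_def)
    have \<omega>_power: "\<omega> j ^ (m * k) = 1" for j
    proof -
      have "\<omega> j ^ m = exp (of_nat m * - (2 * of_real pi * \<i> * of_nat j / of_nat m))"
        unfolding \<omega>_def by (rule exp_of_nat_mult[symmetric])
      also have "of_nat m * - (2 * of_real pi * \<i> * of_nat j / of_nat m)
                  = - (2 * of_real pi * \<i> * of_nat j)"
        using m by simp
      also have "exp \<dots> = 1"
        by (auto simp: exp_eq_1 intro: exI[of _ "- int j"])
      finally show ?thesis by (simp add: power_mult)
    qed
    define u where "u = (\<lambda>q. (\<Sum>j<m. g (\<omega> j * q)) - of_nat m powr w * g (q ^ m))"
    \<comment> \<open>At \<open>q = 0\<close>, which is no value of \<open>exp\<close>, the relation follows by continuity.\<close>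
    have u0: "u q = 0" if q: "q \<in> ball 0 1 - {0}" for q
    proof -
      define v where "v = - Ln q"
      have v: "Re v > 0" "exp (-v) = q" using q by (auto simp: v_def Re_Ln)
      have "g (\<omega> j * q) = lipschitz_sum w (v + 2 * of_real pi * \<i> * of_nat j / of_nat m)" for j
      proof -
        have "\<omega> j * q = exp (- (v + 2 * of_real pi * \<i> * of_nat j / of_nat m))"
          unfolding \<omega>_def v(2)[symmetric] exp_add[symmetric] by (simp add: algebra_simps)
        thus ?thesis using gT[of "v + 2 * of_real pi * \<i> * of_nat j / of_nat m"] v(1) by simp
      qed
      moreover have "g (q ^ m) = lipschitz_sum w (of_nat m * v)"
        using gT[of "of_nat m * v"] v m exp_of_nat_mult[of m "-v"] by simp
      ultimately show ?thesis
        using lipschitz_sum_distribution[OF w v(1) m] by (simp add: u_def)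
    qed
    have "u holomorphic_on ball 0 1"
      unfolding u_def
    proof (intro holomorphic_intros)
      show "(\<lambda>q. g (\<omega> j * q)) holomorphic_on ball 0 1" for j
        by (rule holomorphic_on_compose_gen[of "\<lambda>q. \<omega> j * q" "ball 0 1" g "ball 0 1", unfolded o_def])
           (use g norm_\<omega> in \<open>auto simp: norm_mult intro!: holomorphic_intros\<close>)
      show "(\<lambda>q. g (q ^ m)) holomorphic_on ball 0 1"
        by (rule holomorphic_on_compose_gen[of "\<lambda>q. q ^ m" "ball 0 1" g "ball 0 1", unfolded o_def])
           (use g m in \<open>auto simp: norm_power power_less_one_iff intro!: holomorphic_intros\<close>)
    qed
    hence "isCont u 0"
      by (intro continuous_on_interior[of "ball 0 1"] holomorphic_on_imp_continuous_on) auto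
    hence "(u \<longlongrightarrow> u 0) (at 0)" by (simp add: isCont_def)
    moreover have "(u \<longlongrightarrow> 0) (at 0)"
      by (rule tendsto_eventually) (auto simp: eventually_at intro!: exI[of _ 1] u0)
    ultimately have "u 0 = 0" using tendsto_unique trivial_limit_at by blast
    hence "eventually (\<lambda>q. u q = 0) (nhds 0)"
      using u0 by (auto simp: eventually_nhds_metric intro!: exI[of _ 1])
    hence "u has_fps_expansion 0 \<longleftrightarrow> (\<lambda>_. 0 :: complex) has_fps_expansion 0"
      by (intro has_fps_expansion_cong) auto
    hence "u has_fps_expansion 0" by simp
    moreover have "u has_fps_expansion
        ((\<Sum>j<m. F oo (fps_const (\<omega> j) * fps_X)) - fps_const (of_nat m powr w) * (F oo fps_X ^ m))"
      unfolding u_def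
    proof (intro has_fps_expansion_diff has_fps_expansion_sum has_fps_expansion_cmult_left)
      show "(\<lambda>q. g (\<omega> j * q)) has_fps_expansion (F oo (fps_const (\<omega> j) * fps_X))" for j
        using has_fps_expansion_compose[OF gF has_fps_expansion_cmult_left[OF has_fps_expansion_fps_X]]
        by (simp add: o_def)
      show "(\<lambda>q. g (q ^ m)) has_fps_expansion (F oo fps_X ^ m)"
        using has_fps_expansion_compose[OF gF has_fps_expansion_power[OF has_fps_expansion_fps_X, of m]] m
        by (simp add: o_def)
    qed
    ultimately have "(\<Sum>j<m. F oo (fps_const (\<omega> j) * fps_X)) - fps_const (of_nat m powr w) * (F oo fps_X ^ m) = 0"
      using fps_expansion_unique_complex by blast
    from arg_cong[OF this, of "\<lambda>G. fps_nth G (m * k)"] show ?thesis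
      using m by (simp add: fps_sum_nth \<omega>_power fps_nth_compose_X_power)
  qed
  have norm_m: "norm (of_nat m powr (w - 1) :: complex) = real m powr (Re w - 1)" for m
    by (simp add: norm_powr_real_powr)
  have F: "fps_nth F n = fps_nth F 1 * of_nat n powr (w - 1)" for n
  proof (cases "n = 0")
    case True
    have "norm (2 powr (w - 1) :: complex) \<noteq> 1"
      using norm_m[of 2] w by simp
    hence "2 powr w \<noteq> (2 :: complex)" by (auto simp: powr_diff)
    with hecke[of 2 0] True show ?thesis by simp
  next
    case False
    with hecke[of n 1] show ?thesis by (simp add: powr_diff field_simps)
  qed
  show ?thesis
  proof
    fix y :: complex assume y: "Re y > 0"
    hence "exp (-y) \<in> ball 0 1" by simp
    from holomorphic_power_series[OF g this]
    have "(\<lambda>n. fps_nth F n * exp (-y) ^ n) sums lipschitz_sum w y"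
      using gT[OF y] by (simp add: F_def fps_expansion_def)
    thus "(\<lambda>n. fps_nth F 1 * of_nat n powr (w - 1) * exp (-y) ^ n) sums lipschitz_sum w y"
      by (subst (asm) F)
  qed
qed

section \<open>The polylogarithm near 1\<close>

lemma summable_powr_times_power:
  fixes x :: real
  assumes "0 \<le> x" "x < 1"
  shows "summable (\<lambda>n. real n powr c * x ^ n)"
proof (cases "x = 0")
  case True
  show ?thesis
    by (rule summable_finite[of "{0}"]) (use True in auto)
next
  case False
  with assms have "x > 0" by simp
  have "(\<lambda>n. real n powr c * x ^ n) \<in> O(\<lambda>n. inverse (real n ^ 2))"
    using \<open>x > 0\<close> \<open>x < 1\<close> by real_asymp
  moreover have "summable (\<lambda>n. norm (inverse (real n ^ 2)))"
    using inverse_power_summable[of 2, where 'a = real] by simp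
  ultimately show ?thesis
    by (rule summable_comparison_test_bigo[rotated])
qed

text \<open>
  The sum may start at \<open>n = 0\<close> for every order, since \<open>0 powr (- s) = 0\<close>.
\<close>

definition polylog :: "complex \<Rightarrow> complex \<Rightarrow> complex" where
  "polylog s z = (\<Sum>n. of_nat n powr (-s) * z ^ n)"

lemma norm_of_nat_powr: "norm (of_nat n powr s :: complex) = real n powr Re s"
  by (simp add: norm_powr_real_powr)

lemma polylog_summable:
  fixes z :: complex
  assumes "norm z < 1"
  shows "summable (\<lambda>n. norm (of_nat n powr s * z ^ n :: complex))"
  using summable_powr_times_power[of "norm z" "Re s"] assms
  by (simp add: norm_mult norm_power norm_of_nat_powr)

lemma polylog_sums:
  assumes "norm z < 1"
  shows "(\<lambda>n. of_nat n powr (-s) * z ^ n) sums polylog s z"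
  unfolding polylog_def using summable_norm_cancel[OF polylog_summable[OF assms]] by (rule summable_sums)

text \<open>
  If \<open>a n = o(b n)\<close>, then a tail of the first series is at most \<open>\<epsilon> / 2 * B q\<close>, while its initial
  segment stays bounded and is swallowed by the divergence of \<open>B\<close>.
\<close>

lemma abel_dominated_ratio:
  fixes a :: "nat \<Rightarrow> complex" and b :: "nat \<Rightarrow> real"
  assumes small: "\<And>\<epsilon>. \<epsilon> > 0 \<Longrightarrow> eventually (\<lambda>n. norm (a n) \<le> \<epsilon> * b n) sequentially"
    and b: "\<And>n. b n \<ge> 0"
    and A: "\<And>q. 0 < q \<Longrightarrow> q < 1 \<Longrightarrow> (\<lambda>n. a n * of_real q ^ n) sums A q"
    and B: "\<And>q. 0 < q \<Longrightarrow> q < 1 \<Longrightarrow> (\<lambda>n. b n * q ^ n) sums B q"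
    and lim: "filterlim B at_top (at_left 1)"
  shows "((\<lambda>q. norm (A q) / B q) \<longlongrightarrow> 0) (at_left 1)"
proof (rule tendstoI)
  fix \<epsilon> :: real assume \<epsilon>: "\<epsilon> > 0"
  then obtain N where N: "\<And>n. n \<ge> N \<Longrightarrow> norm (a n) \<le> \<epsilon> / 2 * b n"
    using small[of "\<epsilon> / 2"] by (auto simp: eventually_sequentially)
  define C where "C = (\<Sum>n<N. norm (a n))"
  have "C \<ge> 0" by (auto simp: C_def intro: sum_nonneg)
  have bound: "norm (A q) \<le> C + \<epsilon> / 2 * B q" if q: "0 < q" "q < 1" for q
  proof -
    have fin: "(\<lambda>n. if n \<in> {..<N} then norm (a n) else 0) sums C"
      unfolding C_def by (rule sums_If_finite_set) auto
    have tot: "(\<lambda>n. (if n \<in> {..<N} then norm (a n) else 0) + \<epsilon> / 2 * (b n * q ^ n)) sums (C + \<epsilon> / 2 * B q)"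
      by (intro sums_add fin sums_mult B q)
    have le: "norm (a n * of_real q ^ n) \<le> (if n \<in> {..<N} then norm (a n) else 0) + \<epsilon> / 2 * (b n * q ^ n)" for n
    proof (cases "n < N")
      case True
      have "norm (a n) * q ^ n \<le> norm (a n) * 1"
        using q by (intro mult_left_mono power_le_one) auto
      moreover have "\<epsilon> / 2 * (b n * q ^ n) \<ge> 0" using \<epsilon> b[of n] q by simp
      ultimately show ?thesis using True q by (simp add: norm_mult norm_power)
    next
      case False
      have "norm (a n) * q ^ n \<le> (\<epsilon> / 2 * b n) * q ^ n"
        using q N[of n] False by (intro mult_right_mono) auto
      thus ?thesis using False q by (simp add: norm_mult norm_power mult_ac)
    qed
    have "norm (\<Sum>n. a n * of_real q ^ n) \<le>
            (\<Sum>n. (if n \<in> {..<N} then norm (a n) else 0) + \<epsilon> / 2 * (b n * q ^ n))"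
      by (rule norm_suminf_le[OF le sums_summable[OF tot]])
    thus ?thesis using sums_unique[OF tot] sums_unique[OF A[OF q]] by simp
  qed
  have "eventually (\<lambda>q. B q > 2 * C / \<epsilon> + 1) (at_left 1)"
    using lim by (auto simp: filterlim_at_top_dense)
  moreover have "eventually (\<lambda>q. q \<in> {0<..<1}) (at_left (1 :: real))"
    by (rule eventually_at_left_real) auto
  ultimately show "eventually (\<lambda>q. dist (norm (A q) / B q) 0 < \<epsilon>) (at_left 1)"
  proof eventually_elim
    case (elim q)
    hence Bpos: "B q > 0" using \<open>C \<ge> 0\<close> \<epsilon> by (smt (verit) divide_nonneg_pos)
    have "2 * C / \<epsilon> * \<epsilon> < B q * \<epsilon>" using elim \<epsilon> by (intro mult_strict_right_mono) auto
    hence "C < \<epsilon> / 2 * B q" using \<epsilon> by (simp add: mult_ac)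
    hence "norm (A q) < \<epsilon> * B q" using bound[of q] elim by auto
    thus ?case using Bpos by (simp add: dist_norm field_simps)
  qed
qed

lemma binomial_coeff_asymptotic:
  fixes w :: complex
  shows "(\<lambda>n. (-1) ^ n * ((-w) gchoose n) * of_nat n powr (1 - w)) \<longlonglongrightarrow> inverse (Gamma w)"
proof -
  have "(\<lambda>n. ((-w) gchoose n) / ((-1) ^ n / exp ((-w + 1) * of_real (ln (real n))))) \<longlonglongrightarrow> inverse (Gamma w)"
    using gbinomial_asymptotic[of "-w"] by simp
  moreover have "eventually (\<lambda>n. ((-w) gchoose n) / ((-1) ^ n / exp ((-w + 1) * of_real (ln (real n))))
       = (-1) ^ n * ((-w) gchoose n) * of_nat n powr (1 - w)) sequentially"
    using eventually_gt_at_top[of 0]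
  proof eventually_elim
    case (elim n)
    have "of_nat n powr (1 - w) = exp ((-w + 1) * of_real (ln (real n)))"
      using elim by (simp add: powr_def Ln_of_nat add_ac)
    moreover have "inverse ((-1) ^ n :: complex) = (-1) ^ n"
      by (simp add: power_inverse[symmetric])
    ultimately show ?case by (simp add: divide_inverse)
  qed
  ultimately show ?thesis by (rule Lim_transform_eventually)
qed

text \<open>
  The coefficients \<open>n\<^sup>w\<^sup>-\<^sup>1\<close> are asymptotic to \<open>\<Gamma>(w)\<close> times those of \<open>(1 - q)\<^sup>-\<^sup>w\<close>. The error is compared
  with the coefficients \<open>b n\<close> of \<open>(1 - q)\<^sup>-\<^sup>\<sigma>\<close>, \<open>\<sigma> = Re w\<close>, which are positive and of the same
  order of magnitude.
\<close>

lemma polylog_abelian: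
  assumes w: "Re w > 0"
  shows "((\<lambda>q. of_real (1 - q) powr w * polylog (1 - w) (of_real q)) \<longlongrightarrow> Gamma w) (at_left 1)"
proof -
  define \<sigma> where "\<sigma> = Re w"
  define \<beta> where "\<beta> = (\<lambda>n. (-1) ^ n * ((-w) gchoose n))"
  define b where "b = (\<lambda>n. (-1) ^ n * ((-\<sigma>) gchoose n))"
  define a where "a = (\<lambda>n. of_nat n powr (w - 1) - Gamma w * \<beta> n)"
  have Gamma_nz: "Gamma w \<noteq> 0" "Gamma \<sigma> > 0"
    using w by (auto simp: \<sigma>_def Gamma_eq_zero_iff elim!: nonpos_Ints_cases intro: Gamma_real_pos)
  have b_eq: "b n = pochhammer \<sigma> n / fact n" for n
    unfolding b_def gbinomial_pochhammer by (simp flip: power_mult_distrib mult.assoc)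
  have b_pos: "b n > 0" for n
    using w by (simp add: b_eq \<sigma>_def pochhammer_pos)
  have of_real_b: "of_real (b n) = (-1) ^ n * ((- of_real \<sigma> :: complex) gchoose n)" for n
    unfolding b_def gbinomial_pochhammer by (simp add: pochhammer_of_real)
  have "(\<lambda>n. of_real (b n) * of_nat n powr (1 - of_real \<sigma>)) \<longlonglongrightarrow> inverse (Gamma (of_real \<sigma>) :: complex)"
    using binomial_coeff_asymptotic[of "of_real \<sigma>"] by (simp add: of_real_b)
  hence "(\<lambda>n. norm (of_real (b n) * of_nat n powr (1 - of_real \<sigma>) :: complex)) \<longlonglongrightarrow> norm (inverse (Gamma (of_real \<sigma>) :: complex))"
    by (rule tendsto_norm)
  hence lim_b: "(\<lambda>n. b n * real n powr (1 - \<sigma>)) \<longlonglongrightarrow> inverse (Gamma \<sigma>)"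
    using b_pos Gamma_nz
    by (simp add: norm_mult norm_of_nat_powr abs_of_pos Gamma_complex_of_real flip: of_real_inverse)
  have lim_a: "(\<lambda>n. norm (1 - Gamma w * (\<beta> n * of_nat n powr (1 - w)))) \<longlonglongrightarrow> norm (1 - Gamma w * inverse (Gamma w))"
    unfolding \<beta>_def by (intro tendsto_intros binomial_coeff_asymptotic)
  have lim_ab: "(\<lambda>n. norm (1 - Gamma w * (\<beta> n * of_nat n powr (1 - w))) / (b n * real n powr (1 - \<sigma>))) \<longlonglongrightarrow> 0"
    using tendsto_divide[OF lim_a lim_b] Gamma_nz by simp
  have small: "eventually (\<lambda>n. norm (a n) \<le> \<epsilon> * b n) sequentially" if \<epsilon>: "\<epsilon> > 0" for \<epsilon>
  proof -
    have "eventually (\<lambda>n. norm (1 - Gamma w * (\<beta> n * of_nat n powr (1 - w))) / (b n * real n powr (1 - \<sigma>)) < \<epsilon>) sequentially"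
      using order_tendstoD(2)[OF lim_ab \<epsilon>] .
    thus ?thesis using eventually_gt_at_top[of 0]
    proof eventually_elim
      case (elim n)
      have pw: "(of_nat n powr (1 - w) :: complex) * of_nat n powr (w - 1) = 1"
        using elim by (simp flip: powr_add)
      have "a n = (1 - Gamma w * (\<beta> n * of_nat n powr (1 - w))) * of_nat n powr (w - 1)"
        using pw by (simp add: a_def ring_distribs mult.assoc)
      hence "norm (a n) = norm (1 - Gamma w * (\<beta> n * of_nat n powr (1 - w))) * real n powr (\<sigma> - 1)"
        by (simp add: norm_mult norm_of_nat_powr \<sigma>_def)
      also have "\<dots> \<le> \<epsilon> * (b n * real n powr (1 - \<sigma>)) * real n powr (\<sigma> - 1)"
        using elim b_pos[of n] by (intro mult_right_mono) (auto simp: field_simps)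
      also have "\<dots> = \<epsilon> * b n * (real n powr (1 - \<sigma>) * real n powr (\<sigma> - 1))"
        by (simp only: mult_ac)
      also have "\<dots> = \<epsilon> * b n"
        using elim by (simp flip: powr_add)
      finally show ?case .
    qed
  qed
  define A where "A = (\<lambda>q. polylog (1 - w) (of_real q) - Gamma w * of_real (1 - q) powr (-w))"
  have A: "(\<lambda>n. a n * of_real q ^ n) sums A q" if q: "0 < q" "q < 1" for q
  proof -
    have "(\<lambda>n. \<beta> n * of_real q ^ n) sums of_real (1 - q) powr (-w)"
      using gen_binomial_complex[of "- of_real q" "-w"] q
      by (simp add: \<beta>_def mult.assoc mult.left_commute flip: power_mult_distrib)
    from sums_diff[OF polylog_sums[of "of_real q" "1 - w"] sums_mult[OF this, of "Gamma w"]]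
    show ?thesis using q by (simp add: A_def a_def ring_distribs mult.assoc)
  qed
  have B: "(\<lambda>n. b n * q ^ n) sums ((1 - q) powr (-\<sigma>))" if q: "0 < q" "q < 1" for q
    using gen_binomial_real[of "-q" "-\<sigma>"] q
    by (simp add: b_def mult.assoc mult.left_commute flip: power_mult_distrib)
  have "filterlim (\<lambda>q. (1 - q) powr (-\<sigma>)) at_top (at_left 1)"
    using w unfolding \<sigma>_def[symmetric] by real_asymp
  with small A B b_pos have lim: "((\<lambda>q. norm (A q) / (1 - q) powr (-\<sigma>)) \<longlongrightarrow> 0) (at_left 1)"
    by (intro abel_dominated_ratio[of a b]) (auto intro: less_imp_le)
  have ev: "eventually (\<lambda>q. q \<in> {0<..<1}) (at_left (1 :: real))"
    by (rule eventually_at_left_real) auto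
  have "((\<lambda>q. of_real (1 - q) powr w * A q) \<longlongrightarrow> 0) (at_left 1)"
  proof (rule tendsto_norm_zero_cancel, rule Lim_transform_eventually[OF lim])
    show "eventually (\<lambda>q. norm (A q) / (1 - q) powr (-\<sigma>) = norm (of_real (1 - q) powr w * A q)) (at_left 1)"
      using ev
    proof eventually_elim
      case (elim q)
      hence "norm (of_real (1 - q) powr w :: complex) = (1 - q) powr \<sigma>"
        by (subst norm_powr_real_powr) (auto simp: \<sigma>_def)
      thus ?case by (simp add: norm_mult powr_minus divide_simps)
    qed
  qed
  hence "((\<lambda>q. of_real (1 - q) powr w * A q + Gamma w) \<longlongrightarrow> 0 + Gamma w) (at_left 1)"
    by (intro tendsto_intros)
  moreover have "eventually (\<lambda>q. of_real (1 - q) powr w * A q + Gamma w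
      = of_real (1 - q) powr w * polylog (1 - w) (of_real q)) (at_left 1)"
    using ev
  proof eventually_elim
    case (elim q)
    hence "of_real (1 - q) powr w * (of_real (1 - q) powr (-w) :: complex) = 1"
      by (simp flip: powr_add)
    thus ?case by (simp add: A_def algebra_simps)
  qed
  ultimately show ?thesis by (auto intro: Lim_transform_eventually)
qed

section \<open>Lipschitz' formula\<close>

text \<open>
  Without the term \<open>n = 0\<close> the sum stays bounded and continuous up to \<open>y = 0\<close>, where it becomes a
  multiple of a zeta value.
\<close>

definition lipschitz_tail :: "complex \<Rightarrow> complex \<Rightarrow> complex" where
  "lipschitz_tail w y = (\<Sum>\<^sub>\<infinity>n\<in>- {0::int}. (y + 2 * of_real pi * \<i> * of_int n) powr (-w))"

lemma norm_lipschitz_tail_term_le: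
  assumes n: "n \<noteq> 0" and y: "norm y \<le> 1" and w: "Re w \<ge> 0"
  shows "norm ((y + 2 * of_real pi * \<i> * of_int n) powr (-w))
           \<le> exp (pi * \<bar>Im w\<bar>) * (1 + \<bar>real_of_int n\<bar>) powr (- Re w)"
proof -
  have "\<bar>real_of_int n\<bar> \<ge> 1" using n by linarith
  moreover have "\<bar>real_of_int n\<bar> * 3 \<le> \<bar>real_of_int n\<bar> * pi" using pi_gt3 by (intro mult_left_mono) auto
  moreover have "norm (2 * of_real pi * \<i> * of_int n :: complex) = 2 * (\<bar>real_of_int n\<bar> * pi)"
    by (simp add: norm_mult)
  moreover have "norm (2 * of_real pi * \<i> * of_int n :: complex)
                   \<le> norm (y + 2 * of_real pi * \<i> * of_int n) + norm y"
    by (metis add_diff_cancel_left' norm_triangle_ineq4)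
  ultimately have "1 + \<bar>real_of_int n\<bar> \<le> norm (y + 2 * of_real pi * \<i> * of_int n)"
    using y by linarith
  thus ?thesis
    using norm_powr_uminus_le[of "1 + \<bar>real_of_int n\<bar>" 1 "y + 2 * of_real pi * \<i> * of_int n" w] w
    by simp
qed

lemma summable_on_tail_majorant:
  assumes "\<sigma> > (1::real)"
  shows "(\<lambda>n::int. C * (1 + \<bar>real_of_int n\<bar>) powr (-\<sigma>)) summable_on - {0}"
  by (rule summable_on_subset_banach[OF summable_on_cmult_right[OF summable_on_int_powr[OF assms]]]) auto

lemma lipschitz_tail_summable:
  assumes w: "Re w > 1" and y: "norm y \<le> 1"
  shows "(\<lambda>n. (y + 2 * of_real pi * \<i> * of_int n) powr (-w)) summable_on - {0::int}"
  by (rule abs_summable_summable,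
      rule Infinite_Sum.abs_summable_on_comparison_test'[OF summable_on_tail_majorant[OF w]],
      rule norm_lipschitz_tail_term_le) (use assms in auto)

lemma norm_lipschitz_tail_le:
  assumes \<sigma>: "\<sigma> > 1" "Re w \<ge> \<sigma>" and y: "norm y \<le> 1"
  shows "norm (lipschitz_tail w y)
           \<le> exp (pi * \<bar>Im w\<bar>) * (\<Sum>\<^sub>\<infinity>n\<in>- {0::int}. (1 + \<bar>real_of_int n\<bar>) powr (-\<sigma>))"
proof -
  have "norm (lipschitz_tail w y)
          \<le> (\<Sum>\<^sub>\<infinity>n\<in>- {0::int}. exp (pi * \<bar>Im w\<bar>) * (1 + \<bar>real_of_int n\<bar>) powr (-\<sigma>))"
    unfolding lipschitz_tail_def
  proof (rule norm_infsum_le[OF has_sum_infsum has_sum_infsum])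
    fix n :: int assume "n \<in> - {0}"
    hence "norm ((y + 2 * of_real pi * \<i> * of_int n) powr (-w))
           \<le> exp (pi * \<bar>Im w\<bar>) * (1 + \<bar>real_of_int n\<bar>) powr (- Re w)"
      using assms by (intro norm_lipschitz_tail_term_le) auto
    also have "\<dots> \<le> exp (pi * \<bar>Im w\<bar>) * (1 + \<bar>real_of_int n\<bar>) powr (-\<sigma>)"
      using \<sigma> by (intro mult_left_mono powr_mono) auto
    finally show "norm ((y + 2 * of_real pi * \<i> * of_int n) powr (-w))
           \<le> exp (pi * \<bar>Im w\<bar>) * (1 + \<bar>real_of_int n\<bar>) powr (-\<sigma>)" .
  qed (use assms in \<open>auto intro!: lipschitz_tail_summable summable_on_tail_majorant\<close>)
  thus ?thesis by (simp add: infsum_cmult_right')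
qed

lemma lipschitz_tail_continuous:
  assumes w: "Re w > 1"
  shows "continuous_on {y. Re y \<ge> 0 \<and> norm y \<le> 1} (lipschitz_tail w)"
  unfolding lipschitz_tail_def
proof (rule infsum_continuous_on[OF _ summable_on_tail_majorant[OF w]])
  show "continuous_on {y. Re y \<ge> 0 \<and> norm y \<le> 1} (\<lambda>y. (y + 2 * of_real pi * \<i> * of_int n) powr (-w))"
    if n: "n \<in> - {0}" for n :: int
  proof -
    have "Im y + 2 * pi * of_int n \<noteq> 0" if y: "Re y \<ge> 0 \<and> norm y \<le> 1" for y
    proof
      assume eq: "Im y + 2 * pi * of_int n = 0"
      have "1 \<le> \<bar>real_of_int n\<bar>" using n by auto
      hence "2 * pi \<le> \<bar>2 * pi * of_int n\<bar>" by (simp add: abs_mult)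
      also have "\<dots> = \<bar>Im y\<bar>" using eq by linarith
      also have "\<dots> \<le> 1" using y abs_Im_le_cmod[of y] by auto
      finally show False using pi_gt3 by linarith
    qed
    thus ?thesis
      by (intro continuous_on_powr_complex continuous_intros) (auto simp: complex_eq_iff)
  qed
  show "norm ((y + 2 * of_real pi * \<i> * of_int n) powr (-w))
          \<le> exp (pi * \<bar>Im w\<bar>) * (1 + \<bar>real_of_int n\<bar>) powr (- Re w)"
    if "n \<in> - {0}" "y \<in> {y. Re y \<ge> 0 \<and> norm y \<le> 1}" for n :: int and y
    using that w by (intro norm_lipschitz_tail_term_le) auto
qed

lemma lipschitz_sum_split:
  assumes "Re w > 1" "Re y > 0"
  shows "lipschitz_sum w y = y powr (-w) + lipschitz_tail w y"
proof -
  let ?f = "\<lambda>n::int. (y + 2 * of_real pi * \<i> * of_int n) powr (-w)"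
  have "?f summable_on - {0}"
    by (rule summable_on_subset_banach[OF lipschitz_sum_summable[OF assms]]) auto
  hence "infsum ?f (insert 0 (- {0})) = ?f 0 + infsum ?f (- {0})"
    by (intro infsum_insert) auto
  moreover have "insert 0 (- {0}) = (UNIV :: int set)" by auto
  ultimately show ?thesis by (simp add: lipschitz_sum_def lipschitz_tail_def)
qed

text \<open>
  As \<open>y\<close> tends to \<open>0\<close> along the positive reals, \<open>y\<^sup>w\<close> times the lattice line sum tends to \<open>1\<close>, and
  \<open>y\<^sup>w\<close> times its power series \<open>c \<Sum> n\<^sup>w\<^sup>-\<^sup>1 exp (- n y)\<close> tends to \<open>c \<Gamma>(w)\<close>.
\<close>

theorem lipschitz_formula:
  assumes w: "Re w > 1" and y: "Re y > 0"
  shows "Gamma w * lipschitz_sum w y = polylog (1 - w) (exp (-y))"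
proof -
  obtain c where c: "\<And>y. Re y > 0 \<Longrightarrow>
      (\<lambda>n. c * of_nat n powr (w - 1) * exp (-y) ^ n) sums lipschitz_sum w y"
    using lipschitz_sum_power_series[OF w] by blast
  have cT: "lipschitz_sum w y = c * polylog (1 - w) (exp (-y))" if "Re y > 0" for y
  proof -
    have "norm (exp (-y)) < 1" using that by simp
    from sums_mult[OF polylog_sums[OF this, of "1 - w"], of c] have
      "(\<lambda>n. c * of_nat n powr (w - 1) * exp (-y) ^ n) sums (c * polylog (1 - w) (exp (-y)))"
      by (simp add: mult.assoc)
    thus ?thesis using c[OF that] sums_unique2 by blast
  qed
  have ev: "eventually (\<lambda>t. t \<in> {0<..<1}) (at_right (0 :: real))"
    by (rule eventually_at_right_real) auto
  \<comment> \<open>Only the term \<open>n = 0\<close> is unbounded as \<open>y\<close> tends to \<open>0\<close>.\<close>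
  have lim1: "((\<lambda>t. of_real t powr w * lipschitz_sum w (of_real t)) \<longlongrightarrow> 1) (at_right 0)"
  proof -
    define B where "B = exp (pi * \<bar>Im w\<bar>) * (\<Sum>\<^sub>\<infinity>n\<in>- {0::int}. (1 + \<bar>real_of_int n\<bar>) powr (- Re w))"
    have "((\<lambda>t. of_real t powr w * lipschitz_tail w (of_real t)) \<longlongrightarrow> 0) (at_right 0)"
    proof (rule Lim_null_comparison)
      show "eventually (\<lambda>t. norm (of_real t powr w * lipschitz_tail w (of_real t)) \<le> t powr Re w * B) (at_right 0)"
        using ev
      proof eventually_elim
        case (elim t)
        have "norm (lipschitz_tail w (of_real t)) \<le> B"
          unfolding B_def using w elim by (intro norm_lipschitz_tail_le) auto
        moreover have "norm (of_real t powr w :: complex) = t powr Re w"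
          using elim by (simp add: norm_powr_real_powr)
        ultimately show ?case by (simp add: norm_mult mult_left_mono)
      qed
      have "((\<lambda>t. t powr Re w) \<longlongrightarrow> 0) (at_right 0)" using w by real_asymp
      thus "((\<lambda>t. t powr Re w * B) \<longlongrightarrow> 0) (at_right 0)" by (rule tendsto_mult_left_zero)
    qed
    hence "((\<lambda>t. 1 + of_real t powr w * lipschitz_tail w (of_real t)) \<longlongrightarrow> 1 + 0) (at_right 0)"
      by (intro tendsto_intros)
    moreover have "eventually (\<lambda>t. 1 + of_real t powr w * lipschitz_tail w (of_real t)
                     = of_real t powr w * lipschitz_sum w (of_real t)) (at_right 0)"
      using ev
    proof eventually_elim
      case (elim t)
      hence "of_real t powr w * (of_real t powr (-w) :: complex) = 1"
        by (simp flip: powr_add)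
      thus ?case using elim w by (subst lipschitz_sum_split) (auto simp: algebra_simps)
    qed
    ultimately show ?thesis by (auto intro: Lim_transform_eventually)
  qed
  have lim2: "((\<lambda>t. of_real t powr w * polylog (1 - w) (exp (- of_real t))) \<longlongrightarrow> Gamma w) (at_right 0)"
  proof -
    have "filterlim (\<lambda>t::real. exp (- t)) (at_left 1) (at_right 0)" by real_asymp
    hence "((\<lambda>t. of_real (1 - exp (-t)) powr w * polylog (1 - w) (of_real (exp (-t)))) \<longlongrightarrow> Gamma w) (at_right 0)"
      using w by (intro filterlim_compose[OF polylog_abelian]) auto
    \<comment> \<open>Replacing \<open>1 - q\<close> by \<open>t\<close>, where \<open>q = exp (- t)\<close>, costs a factor that tends to \<open>1\<close>.\<close>
    moreover have "((\<lambda>t. of_real (t / (1 - exp (-t))) powr w :: complex) \<longlongrightarrow> of_real 1 powr w) (at_right 0)"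
    proof (intro tendsto_intros)
      show "((\<lambda>t::real. t / (1 - exp (-t))) \<longlongrightarrow> 1) (at_right 0)" by real_asymp
    qed auto
    ultimately have "((\<lambda>t. of_real (t / (1 - exp (-t))) powr w *
        (of_real (1 - exp (-t)) powr w * polylog (1 - w) (of_real (exp (-t))))) \<longlongrightarrow> of_real 1 powr w * Gamma w) (at_right 0)"
      by (rule tendsto_mult[rotated])
    moreover have "eventually (\<lambda>t. of_real (t / (1 - exp (-t))) powr w *
        (of_real (1 - exp (-t)) powr w * polylog (1 - w) (of_real (exp (-t))))
        = of_real t powr w * polylog (1 - w) (exp (- of_real t))) (at_right 0)"
      using ev
    proof eventually_elim
      case (elim t)
      have "of_real t powr w = (of_real (t / (1 - exp (-t))) * of_real (1 - exp (-t)) :: complex) powr w"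
        using elim by (simp flip: of_real_mult)
      also have "\<dots> = of_real (t / (1 - exp (-t))) powr w * of_real (1 - exp (-t)) powr w"
        by (rule powr_times_real_left) (use elim in auto)
      finally show ?case by (simp add: mult.assoc exp_of_real flip: of_real_minus)
    qed
    ultimately show ?thesis by (auto intro: Lim_transform_eventually)
  qed
  have "((\<lambda>t. of_real t powr w * lipschitz_sum w (of_real t)) \<longlongrightarrow> c * Gamma w) (at_right 0)"
  proof (rule Lim_transform_eventually[OF tendsto_mult[OF tendsto_const lim2, of c]])
    show "eventually (\<lambda>t. c * (of_real t powr w * polylog (1 - w) (exp (- of_real t)))
            = of_real t powr w * lipschitz_sum w (of_real t)) (at_right 0)"
      using ev by eventually_elim (simp add: cT)
  qed
  with lim1 have "c * Gamma w = 1"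
    using tendsto_unique trivial_limit_at_right_real by blast
  thus ?thesis using cT[OF y] by (simp add: mult.left_commute mult.assoc)
qed

section \<open>Analytic continuation and functional equation of the zeta function\<close>

lemma of_nat_times_powr: "of_nat n * of_nat n powr s = (of_nat n powr (s + 1) :: complex)"
  by (cases "n = 0") (simp_all add: powr_add mult.commute)

lemma Re_pos_notin_nonpos_Ints: "Re z > 0 \<Longrightarrow> z \<notin> \<int>\<^sub>\<le>\<^sub>0"
  by (auto elim!: nonpos_Ints_cases)

lemma polylog_has_sum:
  assumes "norm z < 1"
  shows "((\<lambda>n. of_nat n powr (-s) * z ^ n) has_sum polylog s z) UNIV"
  using norm_summable_imp_has_sum[OF polylog_summable[OF assms] polylog_sums[OF assms]] .

text \<open>
  The operator \<open>z d/dz\<close> lowers the order by one; the derivative is stated through \<open>z * D\<close> so that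
  \<open>z = 0\<close> needs no separate treatment.
\<close>

lemma polylog_has_field_derivative:
  assumes "norm z < 1"
  shows "\<exists>D. (polylog s has_field_derivative D) (at z) \<and> z * D = polylog (s - 1) z"
proof -
  let ?c = "\<lambda>n. of_nat n powr (-s) :: complex"
  have summ: "summable (\<lambda>n. ?c n * x ^ n)" if "norm x < 1" for x
    using polylog_sums[OF that, of s] by (rule sums_summable)
  define K where "K = (of_real ((1 + norm z) / 2) :: complex)"
  have K: "norm K = (1 + norm z) / 2" unfolding K_def norm_of_real by simp
  have "((\<lambda>z. \<Sum>n. ?c n * z ^ n) has_field_derivative (\<Sum>n. diffs ?c n * z ^ n)) (at z)"
    using assms K by (intro termdiffs_strong[of _ K] summ) auto
  hence 1: "(polylog s has_field_derivative (\<Sum>n. diffs ?c n * z ^ n)) (at z)"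
    by (simp add: polylog_def[abs_def])
  have "summable (\<lambda>n. diffs ?c n * z ^ n)"
    by (rule termdiff_converges[of z 1]) (use assms summ in auto)
  hence "(\<lambda>n. of_nat n * ?c n * z ^ (n - Suc 0)) sums (\<Sum>n. diffs ?c n * z ^ n)"
    by (rule diffs_equiv)
  hence "(\<lambda>n. z * (of_nat n * ?c n * z ^ (n - Suc 0))) sums (z * (\<Sum>n. diffs ?c n * z ^ n))"
    by (rule sums_mult)
  moreover have "z * (of_nat n * ?c n * z ^ (n - Suc 0)) = of_nat n powr (-(s - 1)) * z ^ n" for n
    using of_nat_times_powr[of n "-s"] by (cases n) (auto simp: mult_ac)
  ultimately have "(\<lambda>n. of_nat n powr (-(s - 1)) * z ^ n) sums (z * (\<Sum>n. diffs ?c n * z ^ n))"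
    by simp
  hence "z * (\<Sum>n. diffs ?c n * z ^ n) = polylog (s - 1) z"
    using polylog_sums[OF assms, of "s - 1"] sums_unique2 by blast
  with 1 show ?thesis by blast
qed

lemma polylog_exp_deriv:
  assumes "Re y > 0"
  shows "((\<lambda>y. polylog s (exp (-y))) has_field_derivative - polylog (s - 1) (exp (-y))) (at y)"
proof -
  have "norm (exp (-y)) < 1" using assms by simp
  then obtain D where D: "(polylog s has_field_derivative D) (at (exp (-y)))"
      "exp (-y) * D = polylog (s - 1) (exp (-y))"
    using polylog_has_field_derivative by blast
  have "((\<lambda>y. exp (-y)) has_field_derivative - exp (-y)) (at y)"
    by (auto intro!: derivative_eq_intros)
  from DERIV_chain2[OF D(1) this] D(2) show ?thesis by (simp add: mult.commute)
qed

lemma polylog_holomorphic_order: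
  assumes z: "norm z < 1"
  shows "(\<lambda>s. polylog s z) holomorphic_on UNIV"
proof -
  have "(\<lambda>s. \<Sum>\<^sub>\<infinity>n. of_nat n powr (-s) * z ^ n) holomorphic_on UNIV"
  proof (rule infsum_holomorphic_on)
    show "(\<lambda>s. of_nat n powr (-s) * z ^ n) holomorphic_on UNIV" for n
      by (cases "n = 0") (auto intro!: holomorphic_intros)
    fix s :: complex
    let ?M = "\<lambda>n. real n powr (norm s + 1) * norm z ^ n"
    have "?M summable_on UNIV"
      using z by (intro summable_nonneg_imp_summable_on summable_powr_times_power) auto
    moreover have "norm (of_nat n powr (-u) * z ^ n) \<le> ?M n" if u: "u \<in> cball s 1" for n u
    proof (cases "n = 0")
      case False
      have "- Re u \<le> norm s + 1"
        using u abs_Re_le_cmod[of u] norm_triangle_ineq2[of u s] by (auto simp: dist_norm norm_minus_commute)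
      hence "real n powr (- Re u) \<le> real n powr (norm s + 1)"
        using False by (intro powr_mono) auto
      thus ?thesis by (simp add: norm_mult norm_power norm_of_nat_powr mult_right_mono)
    qed auto
    ultimately show "\<exists>r>0. \<exists>M. cball s r \<subseteq> UNIV \<and> M summable_on UNIV \<and>
        (\<forall>n\<in>UNIV. \<forall>u\<in>cball s r. norm (of_nat n powr (-u) * z ^ n) \<le> M (n :: nat))"
      by (intro exI[of _ 1] conjI exI[of _ ?M]) auto
  qed auto
  thus ?thesis
    using polylog_has_sum[OF z] by (simp add: has_sum_iff)
qed

text \<open>
  Unless \<open>s\<close> is a positive integer, \<open>polylog s (exp (- y))\<close> behaves near \<open>y = 0\<close> like \<open>\<zeta>(s) + \<Gamma>(1 - s) y\<^sup>s\<^sup>-\<^sup>1\<close>. The \<open>y\<close>-derivative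
  of this polylogarithm is \<open>- polylog (s - 1) (exp (- y))\<close>, so the second summand below is a first order
  Taylor correction: the derivative of the sum is \<open>- y * polylog (s - 2) (exp (- y))\<close>, and
  Lipschitz' formula of order \<open>3 - s\<close> covers it in the whole half-plane \<open>Re s < 2\<close>. The subtracted
  singular part has the coefficient \<open>\<Gamma>(1 - s) + \<Gamma>(2 - s) = \<Gamma>(3 - s) / (1 - s)\<close>, written here in the form
  that shows \<open>s = 1\<close> to be its only pole in that half-plane.
\<close>

definition zeta_approx :: "complex \<Rightarrow> complex \<Rightarrow> complex" where
  "zeta_approx s y = polylog s (exp (-y)) + y * polylog (s - 1) (exp (-y))
                       - Gamma (3 - s) / (1 - s) * y powr (s - 1)"

text \<open>
  The subtracted power cancels exactly the term \<open>n = 0\<close> of Lipschitz' formula, the only term that is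
  singular at \<open>y = 0\<close>.
\<close>

lemma zeta_approx_deriv:
  assumes s: "Re s < 2" "s \<noteq> 1" and y: "Re y > 0"
  shows "(zeta_approx s has_field_derivative - y * Gamma (3 - s) * lipschitz_tail (3 - s) y) (at y)"
proof -
  have y': "y \<notin> \<real>\<^sub>\<le>\<^sub>0" using y by (auto simp: complex_nonpos_Reals_iff)
  have "(zeta_approx s has_field_derivative
      (- polylog (s - 1) (exp (-y)) + (1 * polylog (s - 1) (exp (-y)) + - polylog (s - 1 - 1) (exp (-y)) * y)
        - Gamma (3 - s) / (1 - s) * ((s - 1) * y powr (s - 1 - 1)))) (at y)"
    unfolding zeta_approx_def[abs_def]
    by (intro DERIV_diff DERIV_add DERIV_mult DERIV_ident DERIV_cmult polylog_exp_deriv y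
          has_field_derivative_powr y')
  moreover have p: "polylog (s - 1 - 1) (exp (-y)) = Gamma (3 - s) * (y powr (s - 3) + lipschitz_tail (3 - s) y)"
    using lipschitz_formula[of "3 - s" y] lipschitz_sum_split[of "3 - s" y] s y by (simp add: algebra_simps)
  moreover have g: "Gamma (3 - s) / (1 - s) * ((s - 1) * y powr (s - 1 - 1)) = - Gamma (3 - s) * y powr (s - 2)"
  proof -
    have "Gamma (3 - s) / (1 - s) * ((s - 1) * y powr (s - 1 - 1))
            = Gamma (3 - s) * ((s - 1) / (1 - s)) * y powr (s - 1 - 1)" by simp
    moreover have "(s - 1) / (1 - s) = -1" using s by (simp add: divide_eq_eq)
    moreover have "s - 1 - 1 = s - 2" by simp
    ultimately show ?thesis by simp
  qed
  moreover have pw: "y powr (s - 2) = y powr (s - 3) * y"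
    using powr_add[of y "s - 3" 1] y by auto
  have "- polylog (s - 1) (exp (-y)) + (1 * polylog (s - 1) (exp (-y)) + - polylog (s - 1 - 1) (exp (-y)) * y)
        - Gamma (3 - s) / (1 - s) * ((s - 1) * y powr (s - 1 - 1))
        = - y * Gamma (3 - s) * lipschitz_tail (3 - s) y"
    unfolding p g pw by (simp add: algebra_simps)
  ultimately show ?thesis by simp
qed

text \<open>
  On the convex half-disc \<open>Re y > 0\<close>, \<open>norm y \<le> 1\<close> the derivative is bounded, uniformly for \<open>s\<close> in the
  disc. This yields uniform convergence as \<open>y\<close> tends to \<open>0\<close>.
\<close>

lemma zeta_approx_lipschitz:
  assumes r: "r > 0" "cball s0 r \<subseteq> {s. Re s < 2} - {1}"
  obtains C where "C \<ge> 0" "\<And>s y y'. s \<in> cball s0 r \<Longrightarrow> Re y > 0 \<Longrightarrow> norm y \<le> 1 \<Longrightarrow>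
     Re y' > 0 \<Longrightarrow> norm y' \<le> 1 \<Longrightarrow> norm (zeta_approx s y - zeta_approx s y') \<le> C * norm (y - y')"
proof -
  define \<sigma> where "\<sigma> = 3 - Re s0 - r"
  have "s0 + of_real r \<in> cball s0 r" using r by (simp add: dist_norm)
  hence \<sigma>: "\<sigma> > 1" using r by (fastforce simp: \<sigma>_def)
  have ball: "Re (3 - s) \<ge> \<sigma> \<and> \<bar>Im (3 - s)\<bar> \<le> \<bar>Im s0\<bar> + r" if "s \<in> cball s0 r" for s
  proof -
    have "norm (s0 - s) \<le> r" using that by (simp add: dist_norm)
    thus ?thesis
      using abs_Re_le_cmod[of "s0 - s"] abs_Im_le_cmod[of "s0 - s"] by (auto simp: \<sigma>_def)
  qed
  have "compact ((\<lambda>s. Gamma (3 - s)) ` cball s0 r)"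
  proof (intro compact_continuous_image holomorphic_on_imp_continuous_on holomorphic_intros compact_cball)
    fix s assume "s \<in> cball s0 r"
    thus "3 - s \<notin> \<int>\<^sub>\<le>\<^sub>0" using ball \<sigma> by (intro Re_pos_notin_nonpos_Ints) force
  qed
  hence "bounded ((\<lambda>s. Gamma (3 - s)) ` cball s0 r)" by (rule compact_imp_bounded)
  then obtain G where "\<forall>x\<in>(\<lambda>s. Gamma (3 - s)) ` cball s0 r. norm x \<le> G"
    unfolding bounded_iff by blast
  hence G: "norm (Gamma (3 - s)) \<le> G" if "s \<in> cball s0 r" for s
    using that by blast
  define E where "E = exp (pi * (\<bar>Im s0\<bar> + r)) * (\<Sum>\<^sub>\<infinity>n\<in>- {0::int}. (1 + \<bar>real_of_int n\<bar>) powr (-\<sigma>))"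
  have tail: "norm (lipschitz_tail (3 - s) y) \<le> E" if s: "s \<in> cball s0 r" and y: "norm y \<le> 1" for s y
  proof -
    have "norm (lipschitz_tail (3 - s) y) \<le> exp (pi * \<bar>Im (3 - s)\<bar>) *
            (\<Sum>\<^sub>\<infinity>n\<in>- {0::int}. (1 + \<bar>real_of_int n\<bar>) powr (-\<sigma>))"
      using ball[OF s] by (intro norm_lipschitz_tail_le \<sigma> y) auto
    also have "\<dots> \<le> E"
      unfolding E_def using ball[OF s] by (intro mult_right_mono) (auto intro!: infsum_nonneg)
    finally show ?thesis .
  qed
  have G0: "G \<ge> 0" by (rule order_trans[OF norm_ge_zero G[of s0]]) (use r in simp)
  have E0: "E \<ge> 0" unfolding E_def by (intro mult_nonneg_nonneg infsum_nonneg) auto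
  show ?thesis
  proof (rule that[of "G * E"])
    show "G * E \<ge> 0" using G0 E0 by simp
    fix s y y' assume s: "s \<in> cball s0 r" and y: "Re y > 0" "norm y \<le> 1" "Re y' > 0" "norm y' \<le> 1"
    let ?D = "{y. Re y > 0} \<inter> cball 0 1"
    show "norm (zeta_approx s y - zeta_approx s y') \<le> G * E * norm (y - y')"
    proof (rule field_differentiable_bound[of ?D _ "\<lambda>y. - y * Gamma (3 - s) * lipschitz_tail (3 - s) y"])
      show "convex ?D" by (intro convex_Int convex_cball convex_halfspace_Re_gt)
      show "(zeta_approx s has_field_derivative - z * Gamma (3 - s) * lipschitz_tail (3 - s) z) (at z within ?D)"
        if "z \<in> ?D" for z
        using that s r by (intro has_field_derivative_at_within[OF zeta_approx_deriv]) auto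
      show "norm (- z * Gamma (3 - s) * lipschitz_tail (3 - s) z) \<le> G * E" if "z \<in> ?D" for z
      proof -
        have "norm (- z * Gamma (3 - s)) \<le> 1 * G"
          unfolding norm_mult using that G[OF s] by (intro mult_mono) auto
        thus ?thesis unfolding norm_mult[of "- z * Gamma (3 - s)"]
          using tail[OF s, of z] that G0 by (intro mult_mono) auto
      qed
    qed (use y in auto)
  qed
qed

definition zeta_cont :: "complex \<Rightarrow> complex" where
  "zeta_cont s = lim (\<lambda>k. zeta_approx s (1 / of_nat (Suc k)))"

lemma zeta_cont_uniform_limit:
  assumes r: "r > 0" "cball s0 r \<subseteq> {s. Re s < 2} - {1}"
  shows "uniform_limit (cball s0 r) (\<lambda>k s. zeta_approx s (1 / of_nat (Suc k))) zeta_cont sequentially"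
proof -
  obtain C where C: "C \<ge> 0" "\<And>s y y'. s \<in> cball s0 r \<Longrightarrow> Re y > 0 \<Longrightarrow> norm y \<le> 1 \<Longrightarrow>
     Re y' > 0 \<Longrightarrow> norm y' \<le> 1 \<Longrightarrow> norm (zeta_approx s y - zeta_approx s y') \<le> C * norm (y - y')"
    using zeta_approx_lipschitz[OF r] by blast
  let ?y = "\<lambda>k. 1 / of_nat (Suc k) :: complex"
  have y: "Re (?y k) > 0" "norm (?y k) \<le> 1" for k
    by (simp_all add: norm_divide Re_divide_of_nat del: of_nat_Suc)
  have "?y \<longlonglongrightarrow> 0"
    using LIMSEQ_Suc[OF lim_inverse_n[where 'a = complex]] by (simp add: inverse_eq_divide)
  hence Cau: "Cauchy ?y" by (rule LIMSEQ_imp_Cauchy)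
  have "uniformly_Cauchy_on (cball s0 r) (\<lambda>k s. zeta_approx s (?y k))"
    unfolding uniformly_Cauchy_on_def
  proof (intro allI impI)
    fix e :: real assume "e > 0"
    hence "e / (C + 1) > 0" using C by simp
    then obtain M where M: "\<And>m n. m \<ge> M \<Longrightarrow> n \<ge> M \<Longrightarrow> dist (?y m) (?y n) < e / (C + 1)"
      using Cau unfolding Cauchy_def by metis
    show "\<exists>M. \<forall>s\<in>cball s0 r. \<forall>m\<ge>M. \<forall>n\<ge>M. dist (zeta_approx s (?y m)) (zeta_approx s (?y n)) < e"
    proof (intro exI[of _ M] ballI allI impI)
      fix s m n assume s: "s \<in> cball s0 r" and mn: "m \<ge> M" "n \<ge> M"
      have "norm (zeta_approx s (?y m) - zeta_approx s (?y n)) \<le> C * norm (?y m - ?y n)"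
        by (rule C(2)[OF s y y])
      also have "\<dots> \<le> C * (e / (C + 1))"
        using M[OF mn] C(1) by (intro mult_left_mono) (auto simp: dist_norm)
      also have "\<dots> < e" using C(1) \<open>e > 0\<close> by (simp add: field_simps)
      finally show "dist (zeta_approx s (?y m)) (zeta_approx s (?y n)) < e" by (simp add: dist_norm)
    qed
  qed
  hence "uniformly_convergent_on (cball s0 r) (\<lambda>k s. zeta_approx s (?y k))"
    by (simp add: uniformly_convergent_eq_Cauchy)
  thus ?thesis
    by (simp add: uniformly_convergent_uniform_limit_iff zeta_cont_def[abs_def])
qed

lemma zeta_cont_holomorphic: "zeta_cont holomorphic_on {s. Re s < 2} - {1}"
proof (rule holomorphic_uniform_sequence)
  show op: "open ({s. Re s < 2} - {1})"
    by (intro open_Diff open_halfspace_Re_lt closed_singleton)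
  show "(\<lambda>s. zeta_approx s (1 / of_nat (Suc k))) holomorphic_on {s. Re s < 2} - {1}" for k
    unfolding zeta_approx_def
  proof (intro holomorphic_intros)
    let ?z = "exp (- (1 / of_nat (Suc k))) :: complex"
    have z: "norm ?z < 1" by (simp add: Re_divide_of_nat del: of_nat_Suc)
    show "(\<lambda>s. polylog s ?z) holomorphic_on {s. Re s < 2} - {1}"
      by (rule holomorphic_on_subset[OF polylog_holomorphic_order[OF z]]) auto
    have "(\<lambda>s. polylog s ?z) \<circ> (\<lambda>s. s - 1) holomorphic_on {s. Re s < 2} - {1}"
      by (rule holomorphic_on_compose_gen[OF _ polylog_holomorphic_order[OF z]])
         (auto intro!: holomorphic_intros)
    thus "(\<lambda>s. polylog (s - 1) ?z) holomorphic_on {s. Re s < 2} - {1}" by (simp add: o_def)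
    show "3 - s \<notin> \<int>\<^sub>\<le>\<^sub>0" if "s \<in> {s. Re s < 2} - {1}" for s
      using that by (intro Re_pos_notin_nonpos_Ints) auto
  qed auto
  fix s assume "s \<in> {s. Re s < 2} - {1}"
  then obtain d where "d > 0" "cball s d \<subseteq> {s. Re s < 2} - {1}"
    using op open_contains_cball by blast
  thus "\<exists>d>0. cball s d \<subseteq> {s. Re s < 2} - {1} \<and>
          uniform_limit (cball s d) (\<lambda>k s. zeta_approx s (1 / of_nat (Suc k))) zeta_cont sequentially"
    using zeta_cont_uniform_limit by blast
qed

lemma zeta_cont_eq_limit:
  assumes "((\<lambda>t. zeta_approx s (of_real t)) \<longlongrightarrow> L) (at_right 0)"
  shows "zeta_cont s = L"
proof -
  have "filterlim (\<lambda>k. 1 / real (Suc k)) (at_right 0) sequentially" by real_asymp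
  from filterlim_compose[OF assms this]
  have "(\<lambda>k. zeta_approx s (1 / of_nat (Suc k))) \<longlonglongrightarrow> L" by simp
  thus ?thesis unfolding zeta_cont_def by (rule limI)
qed

definition zeta_series :: "complex \<Rightarrow> complex" where
  "zeta_series s = (\<Sum>\<^sub>\<infinity>n::nat. of_nat n powr (-s))"

lemma summable_on_nat_powr:
  assumes "\<sigma> > (1 :: real)"
  shows "(\<lambda>n. real n powr (-\<sigma>)) summable_on UNIV"
proof (rule summable_nonneg_imp_summable_on)
  show "summable (\<lambda>n. real n powr (-\<sigma>))"
    using assms by (subst summable_real_powr_iff) auto
qed auto

lemma zeta_series_abs_summable:
  assumes "Re s > 1"
  shows "(\<lambda>n. norm (of_nat n powr (-s) :: complex)) summable_on UNIV"
  using summable_on_nat_powr[OF assms] by (simp add: norm_of_nat_powr)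

lemmas zeta_series_has_sum =
  has_sum_infsum[OF abs_summable_summable[OF zeta_series_abs_summable], folded zeta_series_def]

lemma zeta_series_has_sum_pos:
  assumes "Re w > 1"
  shows "((\<lambda>n::nat. of_nat n powr (-w)) has_sum zeta_series w) {1..}"
proof -
  have "((\<lambda>n::nat. of_nat n powr (-w)) has_sum zeta_series w) UNIV \<longleftrightarrow>
        ((\<lambda>n::nat. of_nat n powr (-w)) has_sum zeta_series w) {1..}"
    by (rule has_sum_cong_neutral) (auto simp: not_le)
  thus ?thesis using zeta_series_has_sum[OF assms] by simp
qed

lemma zeta_series_eq_suminf:
  assumes "Re s > 1"
  shows "(\<Sum>n. 1 / of_nat (Suc n) powr s) = zeta_series s"
proof -
  have "(\<lambda>n. of_nat n powr (-s)) sums zeta_series s"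
    by (rule has_sum_imp_sums[OF zeta_series_has_sum[OF assms]])
  hence "(\<lambda>n. of_nat (Suc n) powr (-s)) sums zeta_series s"
    by (subst sums_Suc_iff) simp
  thus ?thesis by (simp add: powr_minus inverse_eq_divide sums_iff del: of_nat_Suc)
qed

lemma zeta_series_holomorphic: "zeta_series holomorphic_on {s. Re s > 1}"
  unfolding zeta_series_def
proof (rule infsum_holomorphic_on)
  show "open {s. Re s > 1}" by (rule open_halfspace_Re_gt)
  show "(\<lambda>s. of_nat n powr (-s)) holomorphic_on {s. Re s > 1}" for n
    by (cases "n = 0") (auto intro!: holomorphic_intros)
  fix s assume s: "s \<in> {s. Re s > 1}"
  define r where "r = (Re s - 1) / 2"
  have r: "r > 0" using s by (simp add: r_def)
  have ball: "Re u \<ge> 1 + r" if "u \<in> cball s r" for u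
  proof -
    have "norm (s - u) \<le> r" using that by (simp add: dist_norm)
    hence "Re s - Re u \<le> r" using abs_Re_le_cmod[of "s - u"] by auto
    moreover have "2 * r = Re s - 1" by (simp add: r_def)
    ultimately show ?thesis by linarith
  qed
  have "(\<lambda>n. real n powr (-(1 + r))) summable_on UNIV"
    using r by (intro summable_on_nat_powr) auto
  moreover have "norm (of_nat n powr (-u) :: complex) \<le> real n powr (-(1 + r))"
    if "u \<in> cball s r" for n u
    using ball[OF that] by (cases "n = 0") (auto simp: norm_of_nat_powr intro!: powr_mono)
  moreover have "cball s r \<subseteq> {s. Re s > 1}"
    using ball r by force
  ultimately show "\<exists>r>0. \<exists>M. cball s r \<subseteq> {s. Re s > 1} \<and> M summable_on UNIV \<and>
      (\<forall>n\<in>UNIV. \<forall>u\<in>cball s r. norm (of_nat n powr (-u) :: complex) \<le> M (n :: nat))"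
    using r by (intro exI[of _ r] conjI exI[of _ "\<lambda>n. real n powr (-(1 + r))"]) auto
qed

text \<open>
  For real \<open>y \<ge> 0\<close> the factor \<open>(1 + n y) exp (- n y)\<close> lies between \<open>0\<close> and \<open>1\<close>, so the regularised series is
  dominated by the Dirichlet series and tends to it, while the subtracted power tends to \<open>0\<close>
  because \<open>Re s > 1\<close>.
\<close>

lemma zeta_cont_eq_series:
  assumes s: "1 < Re s" "Re s < 2"
  shows "zeta_cont s = zeta_series s"
proof (rule zeta_cont_eq_limit)
  let ?f = "\<lambda>n y. of_nat n powr (-s) * ((1 + of_nat n * y) * exp (-y) ^ n) :: complex"
  let ?F = "\<lambda>y. \<Sum>\<^sub>\<infinity>n. ?f n y"
  have bound: "norm ((1 + of_nat n * y) * exp (-y) ^ n) \<le> 1" if "y \<in> complex_of_real ` {0..}" for n :: nat and y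
  proof -
    from that obtain t where t: "y = of_real t" "t \<ge> 0" by auto
    have "(1 + of_nat n * y) * exp (-y) ^ n = of_real ((1 + real n * t) * exp (- (real n * t)))"
      by (simp add: t exp_of_nat_mult[symmetric] exp_of_real[symmetric])
    hence "norm ((1 + of_nat n * y) * exp (-y) ^ n) = (1 + real n * t) * exp (- (real n * t))"
      using t by (simp add: abs_mult del: of_real_mult of_real_add)
    also have "\<dots> \<le> exp (real n * t) * exp (- (real n * t))"
      by (intro mult_right_mono exp_ge_add_one_self) auto
    finally show ?thesis by (simp flip: exp_add)
  qed
  have "continuous_on (of_real ` {0..}) ?F"
  proof (rule infsum_continuous_on[OF _ summable_on_nat_powr[OF s(1)]])
    show "norm (?f n y) \<le> real n powr (- Re s)" if "y \<in> of_real ` {0..}" for n y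
      using mult_left_mono[OF bound[OF that, of n], of "real n powr (- Re s)"]
      by (simp add: norm_mult norm_of_nat_powr)
  qed (intro continuous_intros)
  hence "(?F \<longlongrightarrow> ?F 0) (at 0 within of_real ` {0..})"
    unfolding continuous_on_def by (rule bspec) (auto intro!: image_eqI[of _ _ 0])
  moreover have "filterlim complex_of_real (at 0 within of_real ` {0..}) (at_right 0)"
    unfolding filterlim_at
    by (intro conjI tendsto_eq_intros eventually_at_rightI[of 0 1]) auto
  ultimately have "((\<lambda>t. ?F (of_real t)) \<longlongrightarrow> ?F 0) (at_right 0)"
    by (rule filterlim_compose)
  moreover have "?F 0 = zeta_series s" by (simp add: zeta_series_def)
  moreover have "((\<lambda>t. complex_of_real t powr (s - 1)) \<longlongrightarrow> 0) (at_right 0)"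
  proof (rule tendsto_norm_zero_cancel)
    have "((\<lambda>t. t powr (Re s - 1)) \<longlongrightarrow> 0) (at_right 0)" using s by real_asymp
    moreover have "eventually (\<lambda>t. t powr (Re s - 1) = norm (complex_of_real t powr (s - 1))) (at_right 0)"
      by (rule eventually_at_rightI[of 0 1]) (auto simp: norm_powr_real_powr)
    ultimately show "((\<lambda>t. norm (complex_of_real t powr (s - 1))) \<longlongrightarrow> 0) (at_right 0)"
      by (rule Lim_transform_eventually)
  qed
  ultimately have "((\<lambda>t. ?F (of_real t) - Gamma (3 - s) / (1 - s) * complex_of_real t powr (s - 1))
      \<longlongrightarrow> zeta_series s - Gamma (3 - s) / (1 - s) * 0) (at_right 0)"
    by (intro tendsto_intros) auto
  moreover have "eventually (\<lambda>t. ?F (of_real t) - Gamma (3 - s) / (1 - s) * complex_of_real t powr (s - 1)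
        = zeta_approx s (of_real t)) (at_right 0)"
  proof (rule eventually_at_rightI[of 0 1])
    fix t :: real assume t: "t \<in> {0<..<1}"
    hence z: "norm (exp (- complex_of_real t)) < 1" by simp
    have "((\<lambda>n. of_nat n powr (-s) * exp (- of_real t) ^ n + of_real t * (of_nat n powr (-(s - 1)) * exp (- of_real t) ^ n))
        has_sum (polylog s (exp (- of_real t)) + of_real t * polylog (s - 1) (exp (- of_real t)))) UNIV"
      by (intro has_sum_add has_sum_cmult_right polylog_has_sum z)
    moreover have "of_nat n powr (-s) * exp (- of_real t) ^ n + of_real t * (of_nat n powr (-(s - 1)) * exp (- of_real t) ^ n)
        = ?f n (of_real t)" for n
      using of_nat_times_powr[of n "-s", symmetric] by (simp add: algebra_simps)
    ultimately have "?F (of_real t) = polylog s (exp (- of_real t)) + of_real t * polylog (s - 1) (exp (- of_real t))"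
      by (simp add: has_sum_iff)
    thus "?F (of_real t) - Gamma (3 - s) / (1 - s) * complex_of_real t powr (s - 1) = zeta_approx s (of_real t)"
      by (simp add: zeta_approx_def)
  qed auto
  ultimately show "((\<lambda>t. zeta_approx s (of_real t)) \<longlongrightarrow> zeta_series s) (at_right 0)"
    by (auto intro: Lim_transform_eventually)
qed

text \<open>
  For \<open>Re s < 0\<close> Lipschitz' formula applies to both polylogarithms in \<open>zeta_approx\<close>, and their terms
  \<open>n = 0\<close> add up to the subtracted power.
\<close>

lemma zeta_cont_eq_tail:
  assumes s: "Re s < 0"
  shows "zeta_cont s = Gamma (1 - s) * lipschitz_tail (1 - s) 0"
proof (rule zeta_cont_eq_limit)
  let ?g = "\<lambda>y. Gamma (1 - s) * lipschitz_tail (1 - s) y + y * (Gamma (2 - s) * lipschitz_tail (2 - s) y)"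
  have "continuous_on {y. Re y \<ge> 0 \<and> norm y \<le> 1} ?g"
    using s by (intro continuous_intros lipschitz_tail_continuous) auto
  hence "(?g \<longlongrightarrow> ?g 0) (at 0 within {y. Re y \<ge> 0 \<and> norm y \<le> 1})"
    unfolding continuous_on_def by (rule bspec) simp
  moreover have "filterlim complex_of_real (at 0 within {y. Re y \<ge> 0 \<and> norm y \<le> 1}) (at_right 0)"
    unfolding filterlim_at
    by (intro conjI tendsto_eq_intros eventually_at_rightI[of 0 1]) auto
  ultimately have "((\<lambda>t. ?g (of_real t)) \<longlongrightarrow> ?g 0) (at_right 0)"
    by (rule filterlim_compose)
  moreover have "eventually (\<lambda>t. ?g (of_real t) = zeta_approx s (of_real t)) (at_right 0)"
  proof (rule eventually_at_rightI[of 0 1])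
    fix t :: real assume t: "t \<in> {0<..<1}"
    have p: "polylog (1 - w) (exp (- of_real t)) = Gamma w * (of_real t powr (-w) + lipschitz_tail w (of_real t))"
      if "Re w > 1" for w
      using lipschitz_formula[OF that, of "of_real t"] lipschitz_sum_split[OF that, of "of_real t"] t by simp
    have p1: "polylog s (exp (- of_real t)) = Gamma (1 - s) * (of_real t powr (s - 1) + lipschitz_tail (1 - s) (of_real t))"
      using p[of "1 - s"] s by simp
    have p2: "polylog (s - 1) (exp (- of_real t)) = Gamma (2 - s) * (of_real t powr (s - 2) + lipschitz_tail (2 - s) (of_real t))"
      using p[of "2 - s"] s by simp
    have G2: "Gamma (2 - s) = (1 - s) * Gamma (1 - s)"
      using Gamma_plus1[OF Re_pos_notin_nonpos_Ints, of "1 - s"] s by (simp add: algebra_simps)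
    have G3: "Gamma (3 - s) = (2 - s) * Gamma (2 - s)"
      using Gamma_plus1[OF Re_pos_notin_nonpos_Ints, of "2 - s"] s by (simp add: algebra_simps)
    have G: "Gamma (3 - s) / (1 - s) = Gamma (1 - s) + Gamma (2 - s)"
    proof -
      have "1 - s \<noteq> 0" using s by auto
      thus ?thesis unfolding G3 G2 by (simp add: field_simps)
    qed
    have pw: "of_real t powr (s - 1) = of_real t * (of_real t powr (s - 2) :: complex)"
      using powr_add[of "of_real t :: complex" "s - 2" 1] t by (simp add: mult.commute)
    show "?g (of_real t) = zeta_approx s (of_real t)"
      unfolding zeta_approx_def p1 p2 G pw by (simp add: algebra_simps)
  qed auto
  ultimately show "((\<lambda>t. zeta_approx s (of_real t)) \<longlongrightarrow> Gamma (1 - s) * lipschitz_tail (1 - s) 0) (at_right 0)"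
    by (auto intro: Lim_transform_eventually)
qed

lemma lipschitz_tail_0:
  assumes w: "Re w > 1"
  shows "lipschitz_tail w 0 = ((2 * of_real pi * \<i>) powr (-w) + (- 2 * of_real pi * \<i>) powr (-w)) * zeta_series w"
proof -
  let ?f = "\<lambda>n::int. (2 * of_real pi * \<i> * of_int n) powr (-w)"
  have tail: "(?f has_sum lipschitz_tail w 0) (- {0})"
    using has_sum_infsum[OF lipschitz_tail_summable[OF w, of 0]] by (simp add: lipschitz_tail_def)
  have half: "((\<lambda>n::nat. c * of_nat n powr (-w)) has_sum (c * zeta_series w)) {1..}" for c
    by (rule has_sum_cmult_right[OF zeta_series_has_sum_pos[OF w]])
  have pos: "(?f has_sum ((2 * of_real pi * \<i>) powr (-w) * zeta_series w)) (int ` {1..})"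
  proof (subst has_sum_reindex)
    have "?f (int n) = (2 * of_real pi * \<i>) powr (-w) * of_nat n powr (-w)" for n
      using powr_times_real_left[of "of_nat n" "2 * of_real pi * \<i>" "-w"] by (simp add: mult.commute)
    thus "((?f \<circ> int) has_sum ((2 * of_real pi * \<i>) powr (-w) * zeta_series w)) {1..}"
      using half by (simp add: o_def)
  qed auto
  have neg: "(?f has_sum ((- 2 * of_real pi * \<i>) powr (-w) * zeta_series w)) ((\<lambda>n. - int n) ` {1..})"
  proof (subst has_sum_reindex)
    have "?f (- int n) = (- 2 * of_real pi * \<i>) powr (-w) * of_nat n powr (-w)" for n
      using powr_times_real_left[of "of_nat n" "- 2 * of_real pi * \<i>" "-w"] by (simp add: mult.commute)
    thus "((?f \<circ> (\<lambda>n. - int n)) has_sum ((- 2 * of_real pi * \<i>) powr (-w) * zeta_series w)) {1..}"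
      using half by (simp add: o_def)
  qed (auto simp: inj_on_def)
  have "(?f has_sum ((2 * of_real pi * \<i>) powr (-w) * zeta_series w + (- 2 * of_real pi * \<i>) powr (-w) * zeta_series w))
      (int ` {1..} \<union> (\<lambda>n. - int n) ` {1..})"
    by (intro has_sum_Un_disjoint pos neg) auto
  moreover have "int ` {1..} \<union> (\<lambda>n. - int n) ` {1..} = - {0}"
  proof (intro equalityI subsetI)
    fix n :: int assume "n \<in> - {0}"
    hence "n = int (nat n) \<and> nat n \<ge> 1 \<or> n = - int (nat (-n)) \<and> nat (-n) \<ge> 1" by auto
    thus "n \<in> int ` {1..} \<union> (\<lambda>n. - int n) ` {1..}" by (metis UnI1 UnI2 atLeast_iff imageI)
  qed auto
  ultimately show ?thesis
    using has_sum_unique[OF tail] by (simp add: distrib_right)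
qed

text \<open>
  The two pieces are holomorphic on open sets that cover \<open>- {1}\<close> and agree on the overlap. The identity
  theorem on this connected set gives uniqueness.
\<close>

lemma riemann_zeta_characterization:
  "riemann_zeta = (\<lambda>s. if Re s < 2 \<and> s \<noteq> 1 then zeta_cont s else if s = 1 then 0 else zeta_series s)"
    (is "_ = ?f")
proof -
  have f_series: "?f s = zeta_series s" if "Re s > 1" for s
    using that zeta_cont_eq_series[of s] by auto
  have "?f holomorphic_on ({s. Re s < 2} - {1}) \<union> {s. Re s > 1}"
  proof (rule holomorphic_on_Un)
    show "?f holomorphic_on {s. Re s < 2} - {1}"
      by (rule holomorphic_transform[OF zeta_cont_holomorphic]) auto
    show "?f holomorphic_on {s. Re s > 1}"
      by (rule holomorphic_transform[OF zeta_series_holomorphic]) (use f_series in auto)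
  qed (auto intro!: open_Diff open_halfspace_Re_lt open_halfspace_Re_gt)
  moreover have "({s. Re s < 2} - {1}) \<union> {s. Re s > 1} = - {1 :: complex}" by auto
  ultimately have hol: "?f holomorphic_on - {1}" by simp
  show ?thesis
    unfolding riemann_zeta_def
  proof (rule the_equality)
    show "?f holomorphic_on - {1} \<and> (\<forall>w. 1 < Re w \<longrightarrow> ?f w = (\<Sum>n. 1 / of_nat (Suc n) powr w)) \<and> ?f 1 = 0"
      using hol f_series zeta_series_eq_suminf by auto
  next
    fix g assume g: "g holomorphic_on - {1} \<and> (\<forall>w. 1 < Re w \<longrightarrow> g w = (\<Sum>n. 1 / of_nat (Suc n) powr w)) \<and> g 1 = 0"
    show "g = ?f"
    proof
      fix s
      have "g s = ?f s" if "s \<noteq> 1"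
      proof (rule analytic_continuation_open[of "{s. Re s > 1}" "- {1}" g ?f])
        show "{s. 1 < Re s} \<noteq> {}" by (auto intro!: exI[of _ 2])
        show "connected (- {1 :: complex})"
          by (rule connected_punctured_universe) simp
        show "g z = ?f z" if "z \<in> {s. 1 < Re s}" for z
          using that g f_series[of z] zeta_series_eq_suminf[of z] by auto
      qed (use g hol that in \<open>auto simp: open_halfspace_Re_gt\<close>)
      thus "g s = ?f s" using g by (cases "s = 1") auto
    qed
  qed
qed

lemma riemann_zeta_eq_series:
  assumes "Re s > 1"
  shows "riemann_zeta s = zeta_series s"
  using assms zeta_cont_eq_series[of s] by (auto simp: riemann_zeta_characterization)

theorem riemann_zeta_functional_equation:
  assumes "Re w > 1"
  shows "riemann_zeta (1 - w) =
    Gamma w * ((2 * of_real pi * \<i>) powr (-w) + (- 2 * of_real pi * \<i>) powr (-w)) * riemann_zeta w"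
proof -
  have "riemann_zeta (1 - w) = zeta_cont (1 - w)"
    using assms by (auto simp: riemann_zeta_characterization)
  thus ?thesis
    using zeta_cont_eq_tail[of "1 - w"] lipschitz_tail_0[of w] riemann_zeta_eq_series[of w] assms
    by (simp add: mult.assoc)
qed

section \<open>Principal powers of products\<close>

text \<open>
  Both sides of \<open>Ln z1 + Ln z2 = Ln (z1 * z2)\<close> have the same exponential, and their imaginary parts
  lie in \<open>(0, 2 \<pi>)\<close> and \<open>(0, \<pi>)\<close>, hence differ by less than \<open>2 \<pi>\<close>.
\<close>

lemma powr_mult_upper_half_plane:
  assumes "Im z1 > 0" "Im z2 > 0" "Im (z1 * z2) > 0"
  shows "(z1 * z2) powr a = z1 powr a * z2 powr a"
proof -
  have nz: "z1 \<noteq> 0" "z2 \<noteq> 0" using assms by auto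
  have Im: "0 < Im (Ln z) \<and> Im (Ln z) < pi" if "Im z > 0" for z
    using that by (subst Im_Ln_pos_lt) auto
  have "Ln z1 + Ln z2 = Ln (z1 * z2)"
  proof (rule exp_complex_eqI)
    show "\<bar>Im (Ln z1 + Ln z2) - Im (Ln (z1 * z2))\<bar> < 2 * pi"
      using Im[OF assms(1)] Im[OF assms(2)] Im[OF assms(3)] by auto
  qed (use nz in \<open>auto simp: exp_add\<close>)
  thus ?thesis using nz by (simp add: powr_def flip: exp_add distrib_left)
qed

text \<open>
  Here the arguments of the factors add up to \<open>\<pi>\<close> plus the argument of \<open>u\<close>, which lies in
  \<open>[0, \<pi>)\<close>. The positive reals are included for the terms on the boundary of the quadrant.
\<close>

lemma powr_mult_upper_half_plane_neg:
  assumes "Im z1 > 0" "Im z2 > 0" "z1 * z2 = - u" "Im u > 0 \<or> Im u = 0 \<and> Re u > 0"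
  shows "z1 powr a * z2 powr a = exp (of_real pi * \<i> * a) * u powr a"
proof -
  have nz: "z1 \<noteq> 0" "z2 \<noteq> 0" "u \<noteq> 0" using assms by auto
  have Im: "0 < Im (Ln z) \<and> Im (Ln z) < pi" if "Im z > 0" for z
    using that by (subst Im_Ln_pos_lt) auto
  have Im_u: "0 \<le> Im (Ln u) \<and> Im (Ln u) < pi"
  proof (cases "Im u > 0")
    case False
    thus ?thesis using assms(4) nz Im_Ln_eq_0[of u] by auto
  qed (use Im[of u] in auto)
  have "Ln z1 + Ln z2 = Ln u + of_real pi * \<i>"
  proof (rule exp_complex_eqI)
    show "\<bar>Im (Ln z1 + Ln z2) - Im (Ln u + of_real pi * \<i>)\<bar> < 2 * pi"
      using Im[OF assms(1)] Im[OF assms(2)] Im_u by auto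
  qed (use nz assms(3) in \<open>auto simp: exp_add\<close>)
  hence "a * Ln z1 + a * Ln z2 = of_real pi * \<i> * a + a * Ln u"
    by (simp add: algebra_simps flip: distrib_left)
  thus ?thesis using nz by (simp add: powr_def flip: exp_add)
qed

lemma Ln_pm_two_pi_i:
  "Ln (2 * of_real pi * \<i>) = of_real (ln (2 * pi)) + of_real pi / 2 * \<i>"
  "Ln (- 2 * of_real pi * \<i>) = of_real (ln (2 * pi)) - of_real pi / 2 * \<i>"
proof -
  have L: "Ln (of_real (2 * pi) * z) = of_real (ln (2 * pi)) + Ln z" if "z \<noteq> 0" for z
    using Ln_times_of_real[of "2 * pi" z] Ln_of_real[of "2 * pi"] that by (simp only:) simp
  have "Ln (2 * of_real pi * \<i>) = Ln (of_real (2 * pi) * \<i>)" by simp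
  also have "\<dots> = of_real (ln (2 * pi)) + Ln \<i>" by (rule L) simp
  also have "Ln \<i> = of_real pi / 2 * \<i>" by simp
  finally show "Ln (2 * of_real pi * \<i>) = of_real (ln (2 * pi)) + of_real pi / 2 * \<i>" .
  have "Ln (- 2 * of_real pi * \<i>) = Ln (of_real (2 * pi) * (- \<i>))" by simp
  also have "\<dots> = of_real (ln (2 * pi)) + Ln (- \<i>)" by (rule L) simp
  also have "Ln (- \<i>) = - (of_real pi / 2 * \<i>)" by simp
  finally show "Ln (- 2 * of_real pi * \<i>) = of_real (ln (2 * pi)) - of_real pi / 2 * \<i>" by (simp only: add_uminus_conv_diff)
qed

lemma powr_two_pi_i:
  "(2 * of_real pi * \<i>) powr (-w) = exp (- of_real pi * \<i> * w) * (- 2 * of_real pi * \<i>) powr (-w)"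
proof -
  have "- w * (a + p / 2 * \<i>) = - p * \<i> * w + - w * (a - p / 2 * \<i>)" for a p
    by (simp add: field_simps)
  thus ?thesis unfolding powr_def Ln_pm_two_pi_i by (simp only: exp_add) simp
qed

lemma powr_mult_minus_two_pi_i:
  assumes "Im z > 0"
  shows "(- 2 * of_real pi * \<i> * z) powr a = (- 2 * of_real pi * \<i>) powr a * z powr a"
proof -
  have nz: "z \<noteq> 0" using assms by auto
  have Im: "0 < Im (Ln z) \<and> Im (Ln z) < pi"
    using assms by (subst Im_Ln_pos_lt) auto
  have "Im (Ln (- 2 * of_real pi * \<i>)) = - pi / 2"
    unfolding Ln_pm_two_pi_i by simp
  hence "Ln (- 2 * of_real pi * \<i> * z) = Ln (- 2 * of_real pi * \<i>) + Ln z"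
    using nz Im by (intro Ln_times_simple) auto
  thus ?thesis using nz by (simp add: powr_def exp_add ring_distribs)
qed

section \<open>The lattice sum and its behaviour under inversion\<close>

lemma Im_minus_inverse_pos:
  assumes "Im \<tau> > 0"
  shows "Im (- 1 / \<tau>) > 0"
proof -
  have "(Re \<tau>)\<^sup>2 + (Im \<tau>)\<^sup>2 > 0" using assms by (intro add_nonneg_pos) auto
  thus ?thesis using assms by (simp add: Im_divide)
qed

lemma lattice_lower_bound:
  assumes "Im \<tau> > 0"
  obtains K where "K > 0" "\<And>(m::nat) n::int. real m + \<bar>real_of_int n\<bar> \<le> K * norm (of_nat m * \<tau> + of_int n)"
proof -
  define K where "K = 1 / Im \<tau> + 1 + norm \<tau> / Im \<tau>"
  show ?thesis
  proof (rule that[of K])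
    show "K > 0" using assms by (simp add: K_def add_pos_nonneg)
    fix m :: nat and n :: int
    let ?z = "of_nat m * \<tau> + of_int n"
    have "real m * Im \<tau> \<le> norm ?z" using abs_Im_le_cmod[of ?z] by simp
    hence m: "real m \<le> norm ?z / Im \<tau>" using assms by (simp add: pos_le_divide_eq)
    have "\<bar>real_of_int n\<bar> = norm (?z - of_nat m * \<tau>)" by simp
    also have "\<dots> \<le> norm ?z + norm (of_nat m * \<tau>)" by (rule norm_triangle_ineq4)
    also have "norm (of_nat m * \<tau>) = real m * norm \<tau>" by (simp add: norm_mult)
    also have "\<dots> \<le> norm ?z / Im \<tau> * norm \<tau>" using m by (intro mult_right_mono) auto
    finally show "real m + \<bar>real_of_int n\<bar> \<le> K * norm ?z"
      using m by (simp add: K_def algebra_simps)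
  qed
qed

text \<open>
  The majorant splits into a product because \<open>m (1 + \<bar>n\<bar>) \<le> (m + \<bar>n\<bar>)\<^sup>2\<close> for \<open>m \<ge> 1\<close>; halving the exponent
  is the reason for \<open>Re w > 2\<close>.
\<close>

lemma lattice_abs_summable:
  assumes w: "Re w > 2" and \<tau>: "Im \<tau> > 0"
  shows "(\<lambda>(m::nat, n::int). norm ((of_nat m * \<tau> + of_int n) powr (-w))) summable_on {1..} \<times> UNIV"
proof -
  obtain K where K: "K > 0" "\<And>(m::nat) n::int. real m + \<bar>real_of_int n\<bar> \<le> K * norm (of_nat m * \<tau> + of_int n)"
    using lattice_lower_bound[OF \<tau>] by blast
  let ?s = "Re w / 2"
  let ?C = "exp (pi * \<bar>Im w\<bar>) * K powr Re w"
  have "(\<lambda>(m::nat, n::int). real m powr (-?s) * (1 + \<bar>real_of_int n\<bar>) powr (-?s)) summable_on {1..} \<times> UNIV"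
  proof (rule summable_on_SigmaI)
    show "((\<lambda>n. case (m, n) of (m, n) \<Rightarrow> real m powr (-?s) * (1 + \<bar>real_of_int n\<bar>) powr (-?s)) has_sum
            real m powr (-?s) * (\<Sum>\<^sub>\<infinity>n::int. (1 + \<bar>real_of_int n\<bar>) powr (-?s))) UNIV" for m :: nat
      using w by (auto intro!: has_sum_cmult_right has_sum_infsum summable_on_int_powr)
    show "(\<lambda>m. real m powr (-?s) * (\<Sum>\<^sub>\<infinity>n::int. (1 + \<bar>real_of_int n\<bar>) powr (-?s))) summable_on {1..}"
      using w by (intro summable_on_cmult_left summable_on_subset_banach[OF summable_on_nat_powr]) auto
  qed auto
  hence "(\<lambda>p. ?C * (case p of (m::nat, n::int) \<Rightarrow> real m powr (-?s) * (1 + \<bar>real_of_int n\<bar>) powr (-?s))) summable_on {1..} \<times> UNIV"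
    by (rule summable_on_cmult_right)
  hence "(\<lambda>p. norm (case p of (m::nat, n::int) \<Rightarrow> (of_nat m * \<tau> + of_int n) powr (-w))) summable_on {1..} \<times> UNIV"
  proof (rule Infinite_Sum.abs_summable_on_comparison_test')
    fix p :: "nat \<times> int" assume "p \<in> {1..} \<times> UNIV"
    then obtain m n where p: "p = (m, n)" and m: "m \<ge> 1" by auto
    have "norm ((of_nat m * \<tau> + of_int n) powr (-w)) \<le> ?C * (real m + \<bar>real_of_int n\<bar>) powr (- Re w)"
      using K m w by (intro norm_powr_uminus_le) (auto intro: add_pos_nonneg)
    also have "(real m + \<bar>real_of_int n\<bar>) powr (- Re w) = ((real m + \<bar>real_of_int n\<bar>) powr 2) powr (-?s)"
      by (subst powr_powr) simp
    also have "\<dots> \<le> (real m * (1 + \<bar>real_of_int n\<bar>)) powr (-?s)"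
    proof (rule powr_mono2')
      have "real m * 1 \<le> real m * real m" using m by (intro mult_left_mono) auto
      moreover have "0 \<le> real m * \<bar>real_of_int n\<bar>" "0 \<le> \<bar>real_of_int n\<bar> * \<bar>real_of_int n\<bar>" by auto
      ultimately have "real m * (1 + \<bar>real_of_int n\<bar>) \<le> (real m + \<bar>real_of_int n\<bar>) ^ 2"
        unfolding power2_eq_square ring_distribs mult.commute[of "\<bar>real_of_int n\<bar>" "real m"]
        by linarith
      thus "real m * (1 + \<bar>real_of_int n\<bar>) \<le> (real m + \<bar>real_of_int n\<bar>) powr 2"
        using m by (subst powr_numeral) auto
    qed (use w m in auto)
    also have "\<dots> = real m powr (-?s) * (1 + \<bar>real_of_int n\<bar>) powr (-?s)"
      by (rule powr_mult)
    finally show "norm (case p of (m::nat, n::int) \<Rightarrow> (of_nat m * \<tau> + of_int n) powr (-w))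
        \<le> ?C * (case p of (m::nat, n::int) \<Rightarrow> real m powr (-?s) * (1 + \<bar>real_of_int n\<bar>) powr (-?s))"
      by (simp add: p mult_left_mono)
  qed
  thus ?thesis by (simp add: case_prod_unfold)
qed

definition lattice_sum :: "complex \<Rightarrow> complex \<Rightarrow> complex" where
  "lattice_sum w \<tau> = (\<Sum>\<^sub>\<infinity>(m::nat, n::int)\<in>{1..} \<times> UNIV. (of_nat m * \<tau> + of_int n) powr (-w))"

definition pos_quadrant_sum :: "complex \<Rightarrow> complex \<Rightarrow> complex" where
  "pos_quadrant_sum w \<tau> = (\<Sum>\<^sub>\<infinity>(m::nat, n::nat)\<in>{1..} \<times> {1..}. (of_nat m * \<tau> + of_nat n) powr (-w))"

definition neg_quadrant_sum :: "complex \<Rightarrow> complex \<Rightarrow> complex" where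
  "neg_quadrant_sum w \<tau> = (\<Sum>\<^sub>\<infinity>(m::nat, n::nat)\<in>{1..} \<times> {1..}. (of_nat m * \<tau> - of_nat n) powr (-w))"

lemma lattice_summable:
  assumes "Re w > 2" "Im \<tau> > 0"
  shows "(\<lambda>(m::nat, n::int). (of_nat m * \<tau> + of_int n) powr (-w)) summable_on {1..} \<times> UNIV"
  by (rule abs_summable_summable)
     (use lattice_abs_summable[OF assms] in \<open>simp add: case_prod_unfold\<close>)

lemma of_nat_mult_powr: "(of_nat n * z) powr a = of_nat n powr a * (z powr a :: complex)"
  by (rule powr_times_real_left) auto

lemma pos_quadrant_has_sum:
  assumes "Re w > 2" "Im \<tau> > 0"
  shows "((\<lambda>(m::nat, n::nat). (of_nat m * \<tau> + of_nat n) powr (-w)) has_sum pos_quadrant_sum w \<tau>) ({1..} \<times> {1..})"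
    and "((\<lambda>(m::nat, n::int). (of_nat m * \<tau> + of_int n) powr (-w)) has_sum pos_quadrant_sum w \<tau>)
           ((\<lambda>(m, n). (m, int n)) ` ({1..} \<times> {1..}))"
proof -
  let ?f = "\<lambda>(m::nat, n::int). (of_nat m * \<tau> + of_int n) powr (-w)"
  let ?h = "\<lambda>(m::nat, n::nat). (m, int n)"
  have inj: "inj_on ?h ({1..} \<times> {1..})" by (auto simp: inj_on_def)
  have comp: "?f \<circ> ?h = (\<lambda>(m::nat, n::nat). (of_nat m * \<tau> + of_nat n) powr (-w))" by auto
  have "?f summable_on ?h ` ({1..} \<times> {1..})"
    by (rule summable_on_subset_banach[OF lattice_summable[OF assms]]) auto
  hence "(?f \<circ> ?h) summable_on {1..} \<times> {1..}"
    using summable_on_reindex[OF inj] by blast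
  thus 1: "((\<lambda>(m::nat, n::nat). (of_nat m * \<tau> + of_nat n) powr (-w)) has_sum pos_quadrant_sum w \<tau>) ({1..} \<times> {1..})"
    unfolding pos_quadrant_sum_def comp by (rule has_sum_infsum)
  thus "(?f has_sum pos_quadrant_sum w \<tau>) (?h ` ({1..} \<times> {1..}))"
    using has_sum_reindex[OF inj, of ?f] comp by simp
qed

lemma neg_quadrant_has_sum:
  assumes "Re w > 2" "Im \<tau> > 0"
  shows "((\<lambda>(m::nat, n::int). (of_nat m * \<tau> + of_int n) powr (-w)) has_sum neg_quadrant_sum w \<tau>)
           ((\<lambda>(m, n). (m, - int n)) ` ({1..} \<times> {1..}))"
proof -
  let ?f = "\<lambda>(m::nat, n::int). (of_nat m * \<tau> + of_int n) powr (-w)"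
  let ?h = "\<lambda>(m::nat, n::nat). (m, - int n)"
  have inj: "inj_on ?h ({1..} \<times> {1..})" by (auto simp: inj_on_def)
  have comp: "?f \<circ> ?h = (\<lambda>(m::nat, n::nat). (of_nat m * \<tau> - of_nat n) powr (-w))" by auto
  have "?f summable_on ?h ` ({1..} \<times> {1..})"
    by (rule summable_on_subset_banach[OF lattice_summable[OF assms]]) auto
  hence "(?f \<circ> ?h) summable_on {1..} \<times> {1..}"
    using summable_on_reindex[OF inj] by blast
  hence "((?f \<circ> ?h) has_sum neg_quadrant_sum w \<tau>) ({1..} \<times> {1..})"
    unfolding neg_quadrant_sum_def comp by (rule has_sum_infsum)
  thus ?thesis using has_sum_reindex[OF inj, of ?f] by simp
qed

lemma lattice_sum_split:
  assumes w: "Re w > 2" and \<tau>: "Im \<tau> > 0"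
  shows "lattice_sum w \<tau> = pos_quadrant_sum w \<tau> + \<tau> powr (-w) * zeta_series w + neg_quadrant_sum w \<tau>"
proof -
  let ?f = "\<lambda>(m::nat, n::int). (of_nat m * \<tau> + of_int n) powr (-w)"
  let ?P = "(\<lambda>(m, n). (m, int n)) ` ({1..} \<times> {1..}) :: (nat \<times> int) set"
  let ?N = "(\<lambda>(m, n). (m, - int n)) ` ({1..} \<times> {1..}) :: (nat \<times> int) set"
  let ?Z = "(\<lambda>m. (m, 0)) ` {1..} :: (nat \<times> int) set"
  have "?f \<circ> (\<lambda>m. (m, 0)) = (\<lambda>m::nat. \<tau> powr (-w) * of_nat m powr (-w))"
    using of_nat_mult_powr[of _ \<tau> "-w"] by (simp add: o_def mult.commute[of "\<tau> powr (-w)"])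
  hence "((?f \<circ> (\<lambda>m. (m, 0))) has_sum (\<tau> powr (-w) * zeta_series w)) {1..}"
    using has_sum_cmult_right[OF zeta_series_has_sum_pos, of w "\<tau> powr (-w)"] w by simp
  moreover have "inj_on (\<lambda>m::nat. (m, 0::int)) {1..}" by (rule inj_onI) simp
  ultimately have "(?f has_sum (\<tau> powr (-w) * zeta_series w)) ?Z"
    by (subst has_sum_reindex)
  hence "(?f has_sum (pos_quadrant_sum w \<tau> + \<tau> powr (-w) * zeta_series w + neg_quadrant_sum w \<tau>)) (?P \<union> ?Z \<union> ?N)"
    by (intro has_sum_Un_disjoint pos_quadrant_has_sum neg_quadrant_has_sum assms) auto
  moreover have "?P \<union> ?Z \<union> ?N = {1..} \<times> UNIV"
  proof (intro equalityI subsetI)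
    fix p :: "nat \<times> int" assume "p \<in> {1..} \<times> UNIV"
    then obtain m n where p: "p = (m, n)" "m \<ge> 1" by auto
    consider "n = 0" | "n > 0" | "n < 0" by linarith
    thus "p \<in> ?P \<union> ?Z \<union> ?N"
    proof cases
      case 2
      have "p \<in> ?P" by (rule image_eqI[of _ _ "(m, nat n)"]) (use p 2 in auto)
      thus ?thesis by simp
    next
      case 3
      have "p \<in> ?N" by (rule image_eqI[of _ _ "(m, nat (-n))"]) (use p 3 in auto)
      thus ?thesis by simp
    next
      case 1
      have "p \<in> ?Z" by (rule image_eqI[of _ _ m]) (use p 1 in auto)
      thus ?thesis by simp
    qed
  qed auto
  ultimately show ?thesis by (simp add: lattice_sum_def has_sum_iff)
qed

text \<open>
  The terms match through \<open>\<tau> (m (-1/\<tau>) + n) = n \<tau> - m\<close>, with the roles of \<open>m\<close> and \<open>n\<close>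
  exchanged. All three numbers lie in the upper half-plane.
\<close>

lemma pos_quadrant_sum_inversion:
  assumes "Im \<tau> > 0"
  shows "\<tau> powr (-w) * pos_quadrant_sum w (- 1 / \<tau>) = neg_quadrant_sum w \<tau>"
proof -
  have "\<tau> powr (-w) * pos_quadrant_sum w (- 1 / \<tau>)
        = (\<Sum>\<^sub>\<infinity>(m::nat, n::nat)\<in>{1..} \<times> {1..}. \<tau> powr (-w) * (of_nat m * (- 1 / \<tau>) + of_nat n) powr (-w))"
    unfolding pos_quadrant_sum_def by (simp add: case_prod_unfold infsum_cmult_right')
  also have "\<dots> = neg_quadrant_sum w \<tau>"
    unfolding neg_quadrant_sum_def
  proof (rule infsum_reindex_bij_witness[of _ prod.swap prod.swap])
    fix p :: "nat \<times> nat" assume "p \<in> {1..} \<times> {1..}"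
    then obtain m n where p: "p = (m, n)" "m \<ge> 1" "n \<ge> 1" by auto
    let ?z = "of_nat m * (- 1 / \<tau>) + of_nat n"
    have "\<tau> \<noteq> 0" using assms by auto
    hence prod: "\<tau> * ?z = of_nat n * \<tau> - of_nat m" by (simp add: field_simps)
    have "Im (of_nat m * v + of_nat n) > 0" if "Im v > 0" for v using that p by simp
    hence "Im ?z > 0" using Im_minus_inverse_pos[OF assms] by blast
    hence "(\<tau> * ?z) powr (-w) = \<tau> powr (-w) * ?z powr (-w)"
    proof (rule powr_mult_upper_half_plane[OF assms])
      show "Im (\<tau> * ?z) > 0" unfolding prod using assms p by simp
    qed
    thus "(case prod.swap p of (m, n) \<Rightarrow> (of_nat m * \<tau> - of_nat n) powr (-w)) =
          (case p of (m, n) \<Rightarrow> \<tau> powr (-w) * (of_nat m * (- 1 / \<tau>) + of_nat n) powr (-w))"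
      unfolding prod by (simp add: p)
  qed auto
  finally show ?thesis .
qed

text \<open>
  Now \<open>\<tau> (m (-1/\<tau>) - n) = - (n \<tau> + m)\<close> lies in the lower half-plane, and the passage across the
  cut produces the factor \<open>exp (- \<pi> \<i> w)\<close>.
\<close>

lemma neg_quadrant_sum_inversion:
  assumes "Im \<tau> > 0"
  shows "\<tau> powr (-w) * neg_quadrant_sum w (- 1 / \<tau>) = exp (- of_real pi * \<i> * w) * pos_quadrant_sum w \<tau>"
proof -
  have "\<tau> powr (-w) * neg_quadrant_sum w (- 1 / \<tau>)
        = (\<Sum>\<^sub>\<infinity>(m::nat, n::nat)\<in>{1..} \<times> {1..}. \<tau> powr (-w) * (of_nat m * (- 1 / \<tau>) - of_nat n) powr (-w))"
    unfolding neg_quadrant_sum_def by (simp add: case_prod_unfold infsum_cmult_right')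
  also have "\<dots> = (\<Sum>\<^sub>\<infinity>(m::nat, n::nat)\<in>{1..} \<times> {1..}. exp (- of_real pi * \<i> * w) * (of_nat m * \<tau> + of_nat n) powr (-w))"
  proof (rule infsum_reindex_bij_witness[of _ prod.swap prod.swap])
    fix p :: "nat \<times> nat" assume "p \<in> {1..} \<times> {1..}"
    then obtain m n where p: "p = (m, n)" "m \<ge> 1" "n \<ge> 1" by auto
    let ?z = "of_nat m * (- 1 / \<tau>) - of_nat n"
    have "\<tau> \<noteq> 0" using assms by auto
    hence prod: "\<tau> * ?z = - (of_nat n * \<tau> + of_nat m)" by (simp add: field_simps)
    have "Im (of_nat m * v - of_nat n) > 0" if "Im v > 0" for v using that p by simp
    hence "Im ?z > 0" using Im_minus_inverse_pos[OF assms] by blast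
    hence "\<tau> powr (-w) * ?z powr (-w) = exp (of_real pi * \<i> * (-w)) * (of_nat n * \<tau> + of_nat m) powr (-w)"
      using assms p by (intro powr_mult_upper_half_plane_neg prod) auto
    thus "(case prod.swap p of (m, n) \<Rightarrow> exp (- of_real pi * \<i> * w) * (of_nat m * \<tau> + of_nat n) powr (-w)) =
          (case p of (m, n) \<Rightarrow> \<tau> powr (-w) * (of_nat m * (- 1 / \<tau>) - of_nat n) powr (-w))"
      by (simp add: p)
  qed auto
  also have "\<dots> = exp (- of_real pi * \<i> * w) * pos_quadrant_sum w \<tau>"
    unfolding pos_quadrant_sum_def by (simp add: case_prod_unfold infsum_cmult_right')
  finally show ?thesis .
qed

lemma lattice_sum_inversion:
  assumes w: "Re w > 2" and \<tau>: "Im \<tau> > 0"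
  shows "\<tau> powr (-w) * lattice_sum w (- 1 / \<tau>) = neg_quadrant_sum w \<tau>
           + exp (- of_real pi * \<i> * w) * (zeta_series w + pos_quadrant_sum w \<tau>)"
proof -
  have \<tau>': "Im (- 1 / \<tau>) > 0" by (rule Im_minus_inverse_pos) fact
  have "\<tau> powr (-w) * (- 1 / \<tau>) powr (-w) = exp (of_real pi * \<i> * (-w)) * 1 powr (-w)"
    using \<tau> \<tau>' by (intro powr_mult_upper_half_plane_neg) auto
  thus ?thesis
    using pos_quadrant_sum_inversion[OF \<tau>, of w] neg_quadrant_sum_inversion[OF \<tau>, of w]
    unfolding lattice_sum_split[OF w \<tau>'] by (simp add: ring_distribs flip: mult.assoc)
qed

lemma psi_plus_eq:
  assumes s: "Re s > 1" and \<tau>: "Im \<tau> > 0"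
  shows "psi_plus s \<tau> = pos_quadrant_sum (2 * s) \<tau> + (1 + \<tau> powr (- (2 * s))) * zeta_series (2 * s) / 2"
proof -
  define w where "w = 2 * s"
  have w: "Re w > 2" using s by (simp add: w_def)
  let ?g = "\<lambda>(m::nat, n::nat). (if m = 0 \<or> n = 0 then 1 / 2 else 1) * (1 / (of_nat m * \<tau> + of_nat n) powr w)"
  have g: "?g (m, n) = (if m = 0 \<or> n = 0 then 1 / 2 else 1) * (of_nat m * \<tau> + of_nat n) powr (-w)" for m n
    by (simp add: powr_minus_divide)
  have 1: "(?g has_sum pos_quadrant_sum w \<tau>) ({1..} \<times> {1..})"
    using pos_quadrant_has_sum(1)[OF w \<tau>]
    by (subst has_sum_cong[of _ _ "\<lambda>(m::nat, n::nat). (of_nat m * \<tau> + of_nat n) powr (-w)"]) (auto simp: powr_minus_divide)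
  have z: "((\<lambda>n::nat. c * of_nat n powr (-w)) has_sum c * zeta_series w) {1..}" for c
    using w by (intro has_sum_cmult_right zeta_series_has_sum_pos) auto
  have 2: "(?g has_sum (1 / 2 * \<tau> powr (-w)) * zeta_series w) ((\<lambda>m. (m, 0)) ` {1..})"
  proof (subst has_sum_reindex)
    show "((?g \<circ> (\<lambda>m. (m, 0))) has_sum (1 / 2 * \<tau> powr (-w)) * zeta_series w) {1..}"
      using z[of "1 / 2 * \<tau> powr (-w)"]
      by (subst has_sum_cong[of _ _ "\<lambda>n. 1 / 2 * \<tau> powr (-w) * of_nat n powr (-w)"])
         (auto simp: of_nat_mult_powr powr_minus_divide)
  qed (auto simp: inj_on_def)
  have 3: "(?g has_sum 1 / 2 * zeta_series w) ((\<lambda>n. (0, n)) ` {1..})"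
  proof (subst has_sum_reindex)
    show "((?g \<circ> (\<lambda>n. (0, n))) has_sum 1 / 2 * zeta_series w) {1..}"
      using z[of "1 / 2"]
      by (subst has_sum_cong[of _ _ "\<lambda>n. 1 / 2 * of_nat n powr (-w)"]) (auto simp: powr_minus_divide)
  qed (auto simp: inj_on_def)
  have "(?g has_sum (pos_quadrant_sum w \<tau> + (1 / 2 * \<tau> powr (-w)) * zeta_series w + 1 / 2 * zeta_series w))
      ({1..} \<times> {1..} \<union> (\<lambda>m. (m, 0)) ` {1..} \<union> (\<lambda>n. (0, n)) ` {1..})"
    by (intro has_sum_Un_disjoint 1 2 3) auto
  moreover have "{1..} \<times> {1..} \<union> (\<lambda>m. (m, 0)) ` {1..} \<union> (\<lambda>n. (0, n)) ` {1..} = UNIV - {(0 :: nat, 0 :: nat)}"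
    by (auto simp: image_iff not_le Suc_le_eq)
  ultimately show ?thesis
    unfolding psi_plus_def w_def[symmetric] by (simp add: has_sum_iff field_simps)
qed

section \<open>Eisenstein series as lattice sums\<close>

text \<open>
  From \<open>(m - 1) (d - 1) \<ge> 0\<close> one gets \<open>m d \<ge> m + d - 1\<close>, which bounds the double series by a product
  of two convergent ones; the factor \<open>1 / r\<close> accounts for the \<open>- 1\<close>.
\<close>

lemma lambert_abs_summable:
  fixes q :: complex
  assumes q: "norm q < 1"
  shows "(\<lambda>(m::nat, d::nat). norm (of_nat d powr s * q ^ (m * d))) summable_on {1..} \<times> {1..}"
proof (cases "q = 0")
  case True
  show ?thesis
    by (subst summable_on_cong[of _ _ "\<lambda>_. 0"]) (use True in auto)
next
  case False
  define r where "r = norm q"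
  have r: "0 < r" "r < 1" using q False by (auto simp: r_def)
  have s1: "(\<lambda>m. r ^ m) summable_on {1..}"
    using r by (intro summable_on_subset_banach[OF summable_nonneg_imp_summable_on]) auto
  have s2: "(\<lambda>d. real d powr Re s * r ^ d) summable_on {1..}"
    using r by (intro summable_on_subset_banach[OF summable_nonneg_imp_summable_on] summable_powr_times_power) auto
  have "(\<lambda>(m, d). r ^ m * (real d powr Re s * r ^ d)) summable_on {1..} \<times> {1..}"
  proof (rule summable_on_SigmaI)
    show "((\<lambda>d. case (m, d) of (m, d) \<Rightarrow> r ^ m * (real d powr Re s * r ^ d)) has_sum
            r ^ m * (\<Sum>\<^sub>\<infinity>d\<in>{1..}. real d powr Re s * r ^ d)) {1..}" for m
      using has_sum_cmult_right[OF has_sum_infsum[OF s2], of "r ^ m"] by simp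
    show "(\<lambda>m. r ^ m * (\<Sum>\<^sub>\<infinity>d\<in>{1..}. real d powr Re s * r ^ d)) summable_on {1..}"
      by (intro summable_on_cmult_left s1)
  qed (use r in auto)
  hence "(\<lambda>p. 1 / r * (case p of (m, d) \<Rightarrow> r ^ m * (real d powr Re s * r ^ d))) summable_on {1..} \<times> {1..}"
    by (rule summable_on_cmult_right)
  hence "(\<lambda>p. norm (case p of (m::nat, d::nat) \<Rightarrow> of_nat d powr s * q ^ (m * d))) summable_on {1..} \<times> {1..}"
  proof (rule Infinite_Sum.abs_summable_on_comparison_test')
    fix p :: "nat \<times> nat" assume "p \<in> {1..} \<times> {1..}"
    then obtain m d where p: "p = (Suc m, Suc d)" by (cases p) (auto simp: Suc_le_eq gr0_conv_Suc)
    have "r * r ^ (Suc m * Suc d) = r ^ (Suc m + Suc d) * r ^ (m * d)"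
      by (simp flip: power_add power_Suc) (simp add: algebra_simps)
    also have "\<dots> \<le> r ^ (Suc m + Suc d) * 1"
      using r by (intro mult_left_mono power_le_one) auto
    finally have "r ^ (Suc m * Suc d) \<le> 1 / r * (r ^ Suc m * r ^ Suc d)"
      using r by (simp add: field_simps power_add)
    hence "real (Suc d) powr Re s * r ^ (Suc m * Suc d) \<le> real (Suc d) powr Re s * (1 / r * (r ^ Suc m * r ^ Suc d))"
      by (intro mult_left_mono) auto
    thus "norm (case p of (m::nat, d::nat) \<Rightarrow> of_nat d powr s * q ^ (m * d))
        \<le> 1 / r * (case p of (m, d) \<Rightarrow> r ^ m * (real d powr Re s * r ^ d))"
      by (simp only: p prod.case norm_mult norm_power norm_of_nat_powr r_def[symmetric] mult_ac)
  qed
  thus ?thesis by (simp add: case_prod_unfold)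
qed

text \<open>
  The pairs \<open>(m, d)\<close> are grouped by their product \<open>n = m * d\<close>, so that \<open>d\<close> runs through the divisors
  of \<open>n\<close>.
\<close>

lemma lambert_series:
  fixes q :: complex
  assumes q: "norm q < 1"
  shows "(\<Sum>\<^sub>\<infinity>m\<in>{1..}. polylog (- s) (q ^ m)) = (\<Sum>n. divisor_sum s (Suc n) * q ^ Suc n)"
proof -
  let ?f = "\<lambda>(m::nat, d::nat). of_nat d powr s * q ^ (m * d)"
  have f: "?f summable_on {1..} \<times> {1..}"
    by (rule abs_summable_summable)
       (use lambert_abs_summable[OF q, of s] in \<open>simp add: case_prod_unfold\<close>)
  have inner: "polylog (- s) (q ^ m) = (\<Sum>\<^sub>\<infinity>d\<in>{1..}. ?f (m, d))" if m: "m \<in> {1..}" for m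
  proof -
    have "norm (q ^ m) < 1" using q m by (simp add: norm_power power_less_one_iff)
    from polylog_has_sum[OF this, of "-s"]
    have "((\<lambda>d. of_nat d powr s * (q ^ m) ^ d) has_sum polylog (- s) (q ^ m)) UNIV" by simp
    also have "?this \<longleftrightarrow> ((\<lambda>d. ?f (m, d)) has_sum polylog (- s) (q ^ m)) {1..}"
      by (rule has_sum_cong_neutral) (auto simp: not_le power_mult)
    finally show ?thesis by (simp add: has_sum_iff)
  qed
  let ?h = "\<lambda>(n::nat, d::nat). (n div d, d)"
  have bij: "bij_betw ?h (SIGMA n:{1..}. {d. d dvd n}) ({1..} \<times> {1..})"
    by (rule bij_betwI[where g = "\<lambda>(m, d). (m * d, d)"])
       (auto simp: Suc_le_eq dvd_div_eq_0_iff intro!: Nat.gr0I)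
  have "(\<Sum>\<^sub>\<infinity>m\<in>{1..}. polylog (- s) (q ^ m)) = (\<Sum>\<^sub>\<infinity>m\<in>{1..}. \<Sum>\<^sub>\<infinity>d\<in>{1..}. ?f (m, d))"
    using inner by (rule infsum_cong)
  also have "\<dots> = infsum ?f ({1..} \<times> {1..})"
    using infsum_Sigma_banach[OF f] by simp
  finally have eq: "(\<Sum>\<^sub>\<infinity>m\<in>{1..}. polylog (- s) (q ^ m)) = infsum ?f ({1..} \<times> {1..})" .
  have "(?f has_sum infsum ?f ({1..} \<times> {1..})) ({1..} \<times> {1..})"
    using f by (rule has_sum_infsum)
  hence "((\<lambda>p. ?f (?h p)) has_sum infsum ?f ({1..} \<times> {1..})) (SIGMA n:{1..}. {d. d dvd n})"
    using has_sum_reindex_bij_betw[OF bij, of ?f] by simp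
  hence "((\<lambda>n. divisor_sum s n * q ^ n) has_sum infsum ?f ({1..} \<times> {1..})) {1..}"
  proof (rule has_sum_SigmaD)
    fix n :: nat assume n: "n \<in> {1..}"
    hence fin: "finite {d. d dvd n}" by simp
    have "(\<Sum>d | d dvd n. ?f (?h (n, d))) = divisor_sum s n * q ^ n"
      unfolding divisor_sum_def sum_distrib_right by (intro sum.cong) auto
    thus "((\<lambda>d. ?f (?h (n, d))) has_sum divisor_sum s n * q ^ n) {d. d dvd n}"
      using has_sum_finite[OF fin, of "\<lambda>d. ?f (?h (n, d))"] by simp
  qed
  moreover have "{1..} = range Suc" by (auto simp: image_iff Suc_le_eq gr0_conv_Suc)
  ultimately have "((\<lambda>n. divisor_sum s (Suc n) * q ^ Suc n) has_sum infsum ?f ({1..} \<times> {1..})) UNIV"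
    using has_sum_reindex[of Suc UNIV "\<lambda>n. divisor_sum s n * q ^ n"] by (simp add: o_def)
  hence "(\<lambda>n. divisor_sum s (Suc n) * q ^ Suc n) sums infsum ?f ({1..} \<times> {1..})"
    by (rule has_sum_imp_sums)
  with eq show ?thesis by (simp add: sums_iff)
qed

text \<open>
  Row \<open>m\<close> of the lattice becomes, after multiplication by \<open>- 2 \<pi> \<i>\<close>, the line through
  \<open>y = - 2 \<pi> \<i> m \<tau>\<close>, and Lipschitz' formula turns it into a polylogarithm of \<open>q\<^sup>m\<close>.
\<close>

lemma lattice_sum_q_expansion:
  assumes w: "Re w > 2" and \<tau>: "Im \<tau> > 0"
  shows "(\<Sum>n. divisor_sum (w - 1) (Suc n) * exp (2 * of_real pi * \<i> * \<tau>) ^ Suc n)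
           = Gamma w * (- 2 * of_real pi * \<i>) powr (-w) * lattice_sum w \<tau>"
proof -
  define c where "c = (- 2 * of_real pi * \<i>) powr (-w)"
  have row: "Gamma w * (c * (\<Sum>\<^sub>\<infinity>n::int. (of_nat m * \<tau> + of_int n) powr (-w)))
               = polylog (- (w - 1)) (exp (2 * of_real pi * \<i> * \<tau>) ^ m)" if m: "m \<in> {1..}" for m :: nat
  proof -
    define y where "y = - 2 * of_real pi * \<i> * (of_nat m * \<tau>)"
    have Re_y: "Re y > 0" using m \<tau> by (simp add: y_def)
    have "c * (\<Sum>\<^sub>\<infinity>n::int. (of_nat m * \<tau> + of_int n) powr (-w)) = (\<Sum>\<^sub>\<infinity>n::int. c * (of_nat m * \<tau> + of_int n) powr (-w))"
      by (simp add: infsum_cmult_right')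
    also have "\<dots> = lipschitz_sum w y"
      unfolding lipschitz_sum_def
    proof (rule infsum_reindex_bij_witness[of _ uminus uminus])
      fix n :: int
      have "y + 2 * of_real pi * \<i> * of_int (- n) = - 2 * of_real pi * \<i> * (of_nat m * \<tau> + of_int n)"
        by (simp add: y_def algebra_simps)
      also have "\<dots> powr (-w) = c * (of_nat m * \<tau> + of_int n) powr (-w)"
        unfolding c_def using m \<tau> by (intro powr_mult_minus_two_pi_i) auto
      finally show "(y + 2 * of_real pi * \<i> * of_int (- n)) powr (-w) = c * (of_nat m * \<tau> + of_int n) powr (-w)" .
    qed auto
    also have "Gamma w * lipschitz_sum w y = polylog (1 - w) (exp (-y))"
      using w Re_y by (intro lipschitz_formula) auto
    also have "exp (-y) = exp (2 * of_real pi * \<i> * \<tau>) ^ m"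
      by (simp add: y_def mult_ac flip: exp_of_nat_mult)
    finally show ?thesis by simp
  qed
  have q: "norm (exp (2 * of_real pi * \<i> * \<tau>)) < 1" using \<tau> by simp
  have "lattice_sum w \<tau> = (\<Sum>\<^sub>\<infinity>m\<in>{1..}. \<Sum>\<^sub>\<infinity>n::int. (of_nat m * \<tau> + of_int n) powr (-w))"
    unfolding lattice_sum_def using lattice_summable[OF w \<tau>] by (rule infsum_Sigma'_banach[symmetric])
  hence "Gamma w * c * lattice_sum w \<tau>
           = (\<Sum>\<^sub>\<infinity>m\<in>{1..}. Gamma w * (c * (\<Sum>\<^sub>\<infinity>n::int. (of_nat m * \<tau> + of_int n) powr (-w))))"
    by (simp add: infsum_cmult_right' mult.assoc)
  also have "\<dots> = (\<Sum>\<^sub>\<infinity>m\<in>{1..}. polylog (- (w - 1)) (exp (2 * of_real pi * \<i> * \<tau>) ^ m))"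
    using row by (rule infsum_cong)
  also have "\<dots> = (\<Sum>n. divisor_sum (w - 1) (Suc n) * exp (2 * of_real pi * \<i> * \<tau>) ^ Suc n)"
    by (rule lambert_series[OF q])
  finally show ?thesis by (simp add: c_def)
qed

text \<open>
  In the functional equation \<open>(2 \<pi> \<i>)\<^sup>-\<^sup>w + (- 2 \<pi> \<i>)\<^sup>-\<^sup>w = (1 + exp (- \<pi> \<i> w)) (- 2 \<pi> \<i>)\<^sup>-\<^sup>w\<close>; the Gamma factor
  and the power of \<open>- 2 \<pi> \<i>\<close> are those of the \<open>q\<close>-expansion of the lattice sum, and cancel.
\<close>

lemma eisenstein_eq_lattice_sum:
  assumes w: "Re w > 2" and \<tau>: "Im \<tau> > 0"
  shows "eisenstein w \<tau> = 1 + 2 / ((1 + exp (- of_real pi * \<i> * w)) * zeta_series w) * lattice_sum w \<tau>"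
proof -
  define c where "c = (- 2 * of_real pi * \<i>) powr (-w)"
  have nz: "Gamma w \<noteq> 0" "c \<noteq> 0"
    using w Re_pos_notin_nonpos_Ints[of w] by (auto simp: c_def Gamma_eq_zero_iff)
  have "riemann_zeta (1 - w) = Gamma w * c * ((1 + exp (- of_real pi * \<i> * w)) * zeta_series w)"
    using riemann_zeta_functional_equation[of w] riemann_zeta_eq_series[of w] w
    unfolding powr_two_pi_i c_def by (simp add: algebra_simps)
  thus ?thesis
    unfolding eisenstein_def lattice_sum_q_expansion[OF w \<tau>] c_def[symmetric] using nz by simp
qed

text \<open>
  The terms from \<open>n = 2\<close> on cannot cancel the first one: \<open>1 / n\<^sup>2 \<le> 1 / ((n - 1/2) (n + 1/2))\<close>
  telescopes to \<open>2 / 3\<close>.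
\<close>

lemma zeta_series_nonzero:
  assumes s: "Re s \<ge> 2"
  shows "zeta_series s \<noteq> 0"
proof
  assume z: "zeta_series s = 0"
  have "(\<lambda>n. of_nat n powr (-s)) sums zeta_series s"
    using s by (intro has_sum_imp_sums[OF zeta_series_has_sum]) auto
  hence "(\<lambda>n. of_nat (Suc n) powr (-s)) sums zeta_series s"
    by (subst sums_Suc_iff) simp
  hence "(\<lambda>n. of_nat (Suc (Suc n)) powr (-s)) sums (zeta_series s - 1)"
    by (subst sums_Suc_iff) simp
  hence eq: "(\<Sum>n. of_nat (Suc (Suc n)) powr (-s)) = (-1 :: complex)"
    using z by (simp add: sums_iff)
  have "(\<lambda>n. 1 / (real n + 3 / 2)) \<longlonglongrightarrow> 0" by real_asymp
  from telescope_sums'[OF this]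
  have tele: "(\<lambda>n. 1 / (real n + 3 / 2) - 1 / (real (Suc n) + 3 / 2)) sums (2 / 3)" by simp
  have "norm (\<Sum>n. of_nat (Suc (Suc n)) powr (-s) :: complex) \<le> (\<Sum>n. 1 / (real n + 3 / 2) - 1 / (real (Suc n) + 3 / 2))"
  proof (rule norm_suminf_le[OF _ sums_summable[OF tele]])
    fix n
    have "norm (of_nat (Suc (Suc n)) powr (-s) :: complex) = real (Suc (Suc n)) powr (- Re s)"
      by (simp only: norm_of_nat_powr uminus_complex.sel)
    also have "\<dots> \<le> real (Suc (Suc n)) powr (- 2)" using s by (intro powr_mono) auto
    also have "\<dots> = 1 / (real n + 2) ^ 2"
      by (simp add: powr_minus inverse_eq_divide add_ac)
    also have "\<dots> \<le> 1 / ((real n + 3 / 2) * (real n + 5 / 2))"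
    proof (rule frac_le)
      show "(real n + 3 / 2) * (real n + 5 / 2) \<le> (real n + 2) ^ 2"
        by (simp add: power2_eq_square algebra_simps)
    qed auto
    also have "\<dots> = 1 / (real n + 3 / 2) - 1 / (real (Suc n) + 3 / 2)"
      by (simp add: divide_simps) 
    finally show "norm (of_nat (Suc (Suc n)) powr (-s) :: complex) \<le> 1 / (real n + 3 / 2) - 1 / (real (Suc n) + 3 / 2)" .
  qed
  also have "\<dots> = 2 / 3" using tele by (simp add: sums_iff)
  finally show False unfolding eq by simp
qed

theorem proposition6p3:
  fixes s \<tau> :: complex
  assumes "Re s > 1" and "Im \<tau> > 0"
    and "1 + exp (- 2 * of_real pi * \<i> * s) \<noteq> 0"
  shows "eisenstein_period s \<tau> =
      2 * (1 - exp (- 2 * of_real pi * \<i> * s)) /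
        ((1 + exp (- 2 * of_real pi * \<i> * s)) * riemann_zeta (2 * s)) * psi_plus s \<tau>"
proof -
  define w where "w = 2 * s"
  define e where "e = exp (- of_real pi * \<i> * w)"
  define t where "t = \<tau> powr (-w)"
  define Z where "Z = zeta_series w"
  define A where "A = pos_quadrant_sum w \<tau>"
  define B where "B = neg_quadrant_sum w \<tau>"
  have w: "Re w > 2" using assms by (simp add: w_def)
  have e: "exp (- 2 * of_real pi * \<i> * s) = e" by (simp add: e_def w_def mult_ac)
  have e1: "1 + e \<noteq> 0" using assms(3) unfolding e .
  have Z: "Z \<noteq> 0" unfolding Z_def using w by (intro zeta_series_nonzero) auto
  have \<tau>': "Im (- 1 / \<tau>) > 0"
    by (rule Im_minus_inverse_pos) fact
  have E: "eisenstein w \<tau> = 1 + 2 / ((1 + e) * Z) * (A + t * Z + B)"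
    using eisenstein_eq_lattice_sum[OF w assms(2)] lattice_sum_split[OF w assms(2)]
    by (simp add: e_def Z_def A_def B_def t_def)
  have "eisenstein w (- 1 / \<tau>) = 1 + 2 / ((1 + e) * Z) * lattice_sum w (- 1 / \<tau>)"
    using eisenstein_eq_lattice_sum[OF w \<tau>'] by (simp add: e_def Z_def)
  hence "t * eisenstein w (- 1 / \<tau>) = t + 2 / ((1 + e) * Z) * (t * lattice_sum w (- 1 / \<tau>))"
    by (simp add: algebra_simps)
  also have "t * lattice_sum w (- 1 / \<tau>) = B + e * (Z + A)"
    using lattice_sum_inversion[OF w assms(2)] by (simp add: e_def Z_def A_def B_def t_def)
  finally have E': "t * eisenstein w (- 1 / \<tau>) = t + 2 / ((1 + e) * Z) * (B + e * (Z + A))" .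
  have "eisenstein_period s \<tau> = eisenstein w \<tau> - t * eisenstein w (- 1 / \<tau>)"
    by (simp add: eisenstein_period_def w_def t_def powr_minus_divide)
  also have "\<dots> = 2 * (1 - e) / ((1 + e) * Z) * (A + (1 + t) * Z / 2)"
    unfolding E E' using e1 Z by (simp add: divide_simps) (simp add: algebra_simps)
  also have "A + (1 + t) * Z / 2 = psi_plus s \<tau>"
    using psi_plus_eq[OF assms(1,2)] by (simp add: A_def t_def Z_def w_def)
  also have "Z = riemann_zeta (2 * s)"
    unfolding Z_def w_def[symmetric] using w by (intro riemann_zeta_eq_series[symmetric]) auto
  finally show ?thesis by (simp only: e)
qed

end
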